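(* Fix $q\in(2,4]$. Let $\mathcal{K}$ be a tame knot class such that $\mathscr{C}(\mathcal{K})$ contains a $D_2$-symmetric curve. Let $\vartheta_j\to0$ and, for each $j$, let $\Gamma_{\vartheta_j}\in\mathscr{C}(\mathcal{K})$ be an arclength parametrized $D_2$-symmetric curve with $E_{\vartheta_j}(\Gamma_{\vartheta_j})\le E_{\vartheta_j}(\beta)$ for all $D_2$-symmetric $\beta\in\mathscr{C}(\mathcal{K})$. Then there exist an arclength parametrized $D_2$-symmetric curve $\Gamma_0\in W^{2,2}(\mathbb{R}/\mathbb{Z},\mathbb{R}^3)$ and a subsequence $(\Gamma_{\vartheta_{j_k}})_k$ converging weakly in $W^{2,2}$ and strongly in $C^1$ to $\Gamma_0$ as $k\to\infty$. Moreover, $E(\Gamma_0)\le E(\beta)$ for all $D_2$-symmetric $\beta\in\mathscr{C}(\mathcal{K})$.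
   Context: $\mathscr{L}$ is length; $E(\gamma)=\int_\gamma\kappa^2ds$; for $q\in(2,4]$, $\mathrm{TP}_q(\gamma)=\iint_{(\mathbb{R}/\mathbb{Z})^2} r_{tp}(\gamma(s),\gamma(t))^{-q}|\gamma'(s)||\gamma'(t)|\,ds\,dt$ with $r_{tp}(\gamma(s),\gamma(t))$ the radius of the circle through $\gamma(s),\gamma(t)$ tangent to $\gamma$ at $\gamma(s)$; $E_\vartheta=E+\vartheta\mathrm{TP}_q^{1/(q-2)}$. $\mathscr{C}(\mathcal{K})=\{\gamma\in W^{2,2}(\mathbb{R}/\mathbb{Z},\mathbb{R}^3):\mathscr{L}(\gamma)=1,|\gamma'|>0,\ \gamma\text{ embedded of knot type }\mathcal{K}\}$. A tame knot class is one containing a polygonal representative. (Such symmetric minimizers $\Gamma_\vartheta$ exist for every $\vartheta>0$ under the hypothesis.) $D_2$-symmetry: $R_1=\mathrm{diag}(1,-1,-1)$, $R_2=\mathrm{diag}(-1,1,-1)$, $R_3=\mathrm{diag}(-1,-1,1)$; on $\mathbb{R}/\mathbb{Z}$: $\psi_1(t)=-t+1/2$, $\psi_2(t)=t-1/2$, $\psi_3(t)=-t$. A curve $\gamma\in C^0(\mathbb{R}/\mathbb{Z},\mathbb{R}^3)$ of finite positive length is $D_2$-symmetric if $R_i\gamma(\psi_i(t))=\gamma(t)$ for all $t\in\mathbb{R}/\mathbb{Z}$, $i=1,2,3$. *)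

theory Defs
  imports "HOL-Analysis.Analysis"
begin

type_synonym curve = "real \<Rightarrow> real^3"

text \<open>Curves on R/Z are represented as 1-periodic maps real => real^3.
  First and second (pointwise, a.e. existing) derivatives.\<close>

definition d1 :: "curve \<Rightarrow> real \<Rightarrow> real^3" where
  "d1 \<gamma> t = vector_derivative \<gamma> (at t)"

definition d2 :: "curve \<Rightarrow> real \<Rightarrow> real^3" where
  "d2 \<gamma> t = vector_derivative (d1 \<gamma>) (at t)"

text \<open>W^{2,2}(R/Z,R^3) (continuous C^1 representative): 1-periodic, differentiable
  everywhere, and the derivative is an indefinite integral of an L^2 function.\<close>

definition W22 :: "curve \<Rightarrow> bool" where
  "W22 \<gamma> \<longleftrightarrow> (\<forall>t. \<gamma> (t + 1) = \<gamma> t) \<and> (\<forall>t. \<gamma> differentiable (at t)) \<and>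
     (\<exists>g :: real \<Rightarrow> real^3.
        (\<forall>a b. a \<le> b \<longrightarrow> (g has_integral (d1 \<gamma> b - d1 \<gamma> a)) {a..b}) \<and>
        (\<lambda>t. (norm (g t))\<^sup>2) integrable_on {0..1})"

definition curve_length :: "curve \<Rightarrow> real" where
  "curve_length \<gamma> = integral {0..1} (\<lambda>t. norm (d1 \<gamma> t))"

definition bending :: "curve \<Rightarrow> real" where
  "bending \<gamma> = integral {0..1}
     (\<lambda>t. (norm (cross3 (d1 \<gamma> t) (d2 \<gamma> t)) / norm (d1 \<gamma> t) ^ 3)\<^sup>2 * norm (d1 \<gamma> t))"

text \<open>Inverse of the tangent-point radius: the circle through x and y tangent to the
  direction tau at x has radius |y-x|^2 / (2 dist(y, x + R tau)).\<close>

definition inv_rtp :: "real^3 \<Rightarrow> real^3 \<Rightarrow> real^3 \<Rightarrow> real" where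
  "inv_rtp x \<tau> y = 2 * norm (cross3 (y - x) \<tau>) / (norm \<tau> * (norm (y - x))\<^sup>2)"

definition tp_energy :: "real \<Rightarrow> curve \<Rightarrow> ennreal" where
  "tp_energy q \<gamma> =
     (\<integral>\<^sup>+ s. \<integral>\<^sup>+ t. indicator {0..1} s * indicator {0..1} t *
        ennreal (inv_rtp (\<gamma> s) (d1 \<gamma> s) (\<gamma> t) powr q * norm (d1 \<gamma> s) * norm (d1 \<gamma> t))
      \<partial>lborel \<partial>lborel)"

definition E_theta :: "real \<Rightarrow> real \<Rightarrow> curve \<Rightarrow> ennreal" where
  "E_theta q \<theta> \<gamma> = ennreal (bending \<gamma>) +
     (if tp_energy q \<gamma> = \<infinity> then \<infinity>
      else ennreal (\<theta> * enn2real (tp_energy q \<gamma>) powr (1 / (q - 2))))"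

definition ambient_isotopic :: "(real^3) set \<Rightarrow> (real^3) set \<Rightarrow> bool" where
  "ambient_isotopic A B \<longleftrightarrow> (\<exists>H :: real \<Rightarrow> real^3 \<Rightarrow> real^3.
     continuous_on ({0..1} \<times> UNIV) (\<lambda>(t, x). H t x) \<and>
     (\<forall>t\<in>{0..1}. \<exists>G. homeomorphism UNIV UNIV (H t) G) \<and>
     H 0 = id \<and> H 1 ` A = B)"

definition polygon_curve :: "(nat \<Rightarrow> real^3) \<Rightarrow> nat \<Rightarrow> curve" where
  "polygon_curve v n t = (let s = frac t * real n; k = nat \<lfloor>s\<rfloor> in
      v k + (s - real k) *\<^sub>R (v (Suc k mod n) - v k))"

text \<open>p is an embedded polygonal closed curve (representative of a tame knot class).\<close>

definition embedded_polygon :: "curve \<Rightarrow> bool" where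
  "embedded_polygon p \<longleftrightarrow> (\<exists>v n. 3 \<le> n \<and> p = polygon_curve v n \<and> inj_on p {0..<1})"

text \<open>C(K), where K is the knot class of the embedded closed curve p.\<close>

definition CK :: "curve \<Rightarrow> curve set" where
  "CK p = {\<gamma>. W22 \<gamma> \<and> curve_length \<gamma> = 1 \<and> (\<forall>t. d1 \<gamma> t \<noteq> 0) \<and>
             inj_on \<gamma> {0..<1} \<and> ambient_isotopic (p ` {0..1}) (\<gamma> ` {0..1})}"

definition R1 :: "real^3 \<Rightarrow> real^3" where "R1 x = vector [x$1, - x$2, - x$3]"
definition R2 :: "real^3 \<Rightarrow> real^3" where "R2 x = vector [- x$1, x$2, - x$3]"
definition R3 :: "real^3 \<Rightarrow> real^3" where "R3 x = vector [- x$1, - x$2, x$3]"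

definition D2_symmetric :: "curve \<Rightarrow> bool" where
  "D2_symmetric \<gamma> \<longleftrightarrow>
     (\<forall>t. R1 (\<gamma> (- t + 1/2)) = \<gamma> t) \<and>
     (\<forall>t. R2 (\<gamma> (t - 1/2)) = \<gamma> t) \<and>
     (\<forall>t. R3 (\<gamma> (- t)) = \<gamma> t)"

definition arclength :: "curve \<Rightarrow> bool" where
  "arclength \<gamma> \<longleftrightarrow> (\<forall>t. norm (d1 \<gamma> t) = 1)"

definition W22_inner :: "curve \<Rightarrow> curve \<Rightarrow> real" where
  "W22_inner u w = integral {0..1}
     (\<lambda>t. u t \<bullet> w t + d1 u t \<bullet> d1 w t + d2 u t \<bullet> d2 w t)"

definition W22_weak_conv :: "(nat \<Rightarrow> curve) \<Rightarrow> curve \<Rightarrow> bool" where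
  "W22_weak_conv f g \<longleftrightarrow> (\<forall>w. W22 w \<longrightarrow> (\<lambda>k. W22_inner (f k) w) \<longlonglongrightarrow> W22_inner g w)"

definition C1_conv :: "(nat \<Rightarrow> curve) \<Rightarrow> curve \<Rightarrow> bool" where
  "C1_conv f g \<longleftrightarrow> uniform_limit UNIV f g sequentially \<and>
     uniform_limit UNIV (\<lambda>k. d1 (f k)) (d1 g) sequentially"

end

theory Submission
  imports Defs "HOL-Complex_Analysis.Great_Picard"
begin

text \<open>Every competitor has finite tangent-point energy because $W^{2,2}$ embeds into the critical
  space $W^{7/4,4}$: with $f=|\gamma''|$ the tangent-point integrand at $(s,t)$ is dominated by a power of
  the mean of \<open>f\<close> between \<open>s\<close> and \<open>t\<close>, whose fourth power is integrable by an iterated Hardy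
  inequality.  Hence the bending energies of the minimizers are bounded by
  $E(\beta)+\vartheta_j\,T(\beta)$ for every competitor \<open>\<beta>\<close>.  Arzela--Ascoli gives a $C^1$ limit, the
  symmetry preventing escape by translations, and weak lower semicontinuity of the $L^2$-norm of
  the second derivative gives both the regularity of the limit and its minimality.\<close>

section \<open>Hardy-type inequalities\<close>

text \<open>The penalty matters only through the competitor: if \<open>tp_energy q \<beta>\<close>
  were infinite, minimality would say nothing about \<open>bending \<beta>\<close>. The estimate
  excluding this is scale critical. Cauchy-Schwarz bounds the squared mean of f over an interval of
  length h by the squared L2 norm divided by h; spending this on two of the four factors leaves the
  logarithmically divergent integral of 1/h, so two factors are traded for endpoint values of f
  instead. The power 4 is the largest admissible q. The limit curve is not claimed to lie in
  \<open>CK p\<close>, since embeddedness can be lost; only unit speed and symmetry, which are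
  closed under C1 limits, and information on the second derivative are carried over. The latter
  always comes from one selection principle, \<open>L2_weak_limit_exists\<close>, applied to the
  increments of the limit velocity as linear constraints, with one more test function when weak
  convergence is wanted.\<close>

lemma nn_integral_indicator_has_integral:
  fixes f :: "'a::euclidean_space \<Rightarrow> real"
  assumes "\<And>x. x \<in> S \<Longrightarrow> 0 \<le> f x" and "(f has_integral I) S"
  shows "(\<integral>\<^sup>+x. indicator S x * ennreal (f x) \<partial>lborel) = ennreal I"
proof -
  have "(\<integral>\<^sup>+x. indicator S x * ennreal (f x) \<partial>lborel) = (\<integral>\<^sup>+x. ennreal (indicator S x * f x) \<partial>lborel)"
    by (intro nn_integral_cong) (auto simp: indicator_def)
  then show ?thesis
    using nn_integral_has_integral_lebesgue[OF assms] by simp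
qed

lemma two_mult_le_sum_squares_ennreal: "2 * (a * b) \<le> a\<^sup>2 + (b::ennreal)\<^sup>2"
proof (cases "a = top \<or> b = top")
  case True
  then show ?thesis by (auto simp: power2_eq_square ennreal_top_mult ennreal_mult_top)
next
  case False
  then obtain x y where xy: "a = ennreal x" "b = ennreal y" "0 \<le> x" "0 \<le> y"
    by (metis ennreal_cases)
  have "2 * (x * y) \<le> x\<^sup>2 + y\<^sup>2"
    using sum_squares_bound[of x y] by (simp add: mult.assoc)
  then have "ennreal (2 * (x * y)) \<le> ennreal (x\<^sup>2 + y\<^sup>2)"
    by (rule ennreal_leI)
  then show ?thesis
    using xy by (simp add: ennreal_mult ennreal_power)
qed

text \<open>The squared left side is a double integral of (f x g y)(f y g x), and 2ab <= a^2 + b^2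
  symmetrises it into two equal product integrals. Nothing is divided by a norm, so the values 0 and
  infinity on the right cause no case split.\<close>

lemma nn_integral_Cauchy_Schwarz:
  assumes [measurable]: "f \<in> borel_measurable M" "g \<in> borel_measurable M"
  shows "(\<integral>\<^sup>+x. f x * g x \<partial>M)\<^sup>2 \<le> (\<integral>\<^sup>+x. (f x)\<^sup>2 \<partial>M) * (\<integral>\<^sup>+x. (g x)\<^sup>2 \<partial>M)" (is "?I\<^sup>2 \<le> ?F * ?G")
proof -
  have "2 * ?I\<^sup>2 = (\<integral>\<^sup>+x. \<integral>\<^sup>+y. 2 * ((f x * g y) * (f y * g x)) \<partial>M \<partial>M)"
  proof -
    have "(\<integral>\<^sup>+x. \<integral>\<^sup>+y. 2 * ((f x * g y) * (f y * g x)) \<partial>M \<partial>M)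
       = (\<integral>\<^sup>+x. \<integral>\<^sup>+y. (2 * (f x * g x)) * (f y * g y) \<partial>M \<partial>M)"
      by (intro nn_integral_cong) (simp add: ac_simps)
    also have "\<dots> = 2 * ?I\<^sup>2"
      by (subst nn_integral_cmult, simp, subst nn_integral_multc, simp, subst nn_integral_cmult)
         (simp_all add: power2_eq_square ac_simps)
    finally show ?thesis by simp
  qed
  also have "\<dots> \<le> (\<integral>\<^sup>+x. \<integral>\<^sup>+y. (f x * g y)\<^sup>2 + (f y * g x)\<^sup>2 \<partial>M \<partial>M)"
    by (intro nn_integral_mono two_mult_le_sum_squares_ennreal)
  also have "\<dots> = 2 * (?F * ?G)"
    by (simp add: power_mult_distrib nn_integral_add nn_integral_cmult nn_integral_multc mult_2 ac_simps)
  finally show ?thesis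
    by (simp add: ennreal_mult_le_mult_iff)
qed

section \<open>Masses and averages over initial intervals\<close>

definition initial_mass :: "(real \<Rightarrow> ennreal) \<Rightarrow> real \<Rightarrow> ennreal" where
  "initial_mass f h = (\<integral>\<^sup>+y. (if 0 < y \<and> y < h then f y else 0) \<partial>lborel)"

lemma initial_mass_mono: "h \<le> k \<Longrightarrow> initial_mass f h \<le> initial_mass f k"
  unfolding initial_mass_def by (intro nn_integral_mono) auto

lemma measurable_initial_mass [measurable]:
  assumes [measurable]: "f \<in> borel_measurable borel"
  shows "initial_mass f \<in> borel_measurable borel"
  unfolding initial_mass_def[abs_def] by measurable

text \<open>The point halving the mass of (0,h) comes from the intermediate value theorem. It takes
  the place of differentiating powers of the primitive of f in
  \<open>initial_mass_power_le\<close>.\<close>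

lemma initial_mass_median:
  assumes [measurable]: "f \<in> borel_measurable borel" and fin: "initial_mass f h < \<infinity>" and "0 < h"
  obtains m where "0 \<le> m" "m \<le> h" "2 * initial_mass f m = initial_mass f h"
    "2 * (\<integral>\<^sup>+y. (if m \<le> y \<and> y < h then f y else 0) \<partial>lborel) = initial_mass f h"
proof -
  \<comment> \<open>Finite mass makes f finite almost everywhere on (0,h), so it has a real-valued
    copy, whose Henstock-Kurzweil primitive is continuous.\<close>
  define g where "g y = (if 0 < y \<and> y < h then enn2real (f y) else 0)" for y
  have [measurable]: "g \<in> borel_measurable borel"
    unfolding g_def[abs_def] by measurable
  have g0: "0 \<le> g y" for y by (simp add: g_def)
  have "AE y in lborel. (if 0 < y \<and> y < h then f y else 0) \<noteq> \<infinity>"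
    using fin unfolding initial_mass_def by (intro nn_integral_noteq_infinite) auto
  then have ae: "AE y in lborel. (if 0 < y \<and> y < h then f y else 0) = ennreal (g y)"
    by eventually_elim (auto simp: g_def less_top)
  have sub: "(\<integral>\<^sup>+y. (if P y then f y else 0) \<partial>lborel) = (\<integral>\<^sup>+y. ennreal (g y) * indicator {y. P y} y \<partial>lborel)"
    if "\<And>y. P y \<Longrightarrow> 0 < y \<and> y < h" for P
    using ae by (intro nn_integral_cong_AE) (auto split: if_splits dest: that)
  have gfin: "(\<integral>\<^sup>+y. ennreal (g y) \<partial>lborel) < \<infinity>"
    using fin unfolding initial_mass_def by (subst nn_integral_cong_AE[OF ae, symmetric])
  have intg: "g integrable_on UNIV"
    by (rule nn_integral_integrable_on[OF _ g0 gfin]) simp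
  have intab: "g integrable_on {a..b}" for a b
    using intg by (rule integrable_on_subinterval) auto
  \<comment> \<open>The endpoints are exempt, so that one identity serves both the open interval of
    \<open>initial_mass\<close> and the part to the right of the median.\<close>
  have nn: "(\<integral>\<^sup>+y. (if P y then f y else 0) \<partial>lborel) = ennreal (integral {a..b} g)"
    if "\<And>y. P y \<Longrightarrow> 0 < y \<and> y < h" "\<And>y. y \<noteq> a \<Longrightarrow> y \<noteq> b \<Longrightarrow> P y \<longleftrightarrow> a \<le> y \<and> y \<le> b"  for P a b
  proof -
    have ab: "AE y in lborel. y \<noteq> a" "AE y in lborel. y \<noteq> b"
      by (rule AE_lborel_singleton)+
    have "AE y in lborel. ennreal (g y) * indicator {y. P y} y = indicator {a..b} y * ennreal (g y)"
      using ab by eventually_elim (auto simp: that(2) indicator_def)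
    then have "(\<integral>\<^sup>+y. ennreal (g y) * indicator {y. P y} y \<partial>lborel)
        = (\<integral>\<^sup>+y. indicator {a..b} y * ennreal (g y) \<partial>lborel)"
      by (rule nn_integral_cong_AE)
    also have "\<dots> = ennreal (integral {a..b} g)"
      by (rule nn_integral_indicator_has_integral) (auto simp: g0 intab)
    finally show ?thesis using sub[OF that(1)] by simp
  qed
  define G where "G m = integral {0..m} g" for m
  have Gm: "initial_mass f m = ennreal (G m)" if "0 \<le> m" "m \<le> h" for m
    unfolding initial_mass_def G_def using that by (intro nn) auto
  have "continuous_on {0..h} G"
    unfolding G_def by (rule indefinite_integral_continuous_1[OF intab])
  moreover have "0 \<le> G h"
    unfolding G_def by (rule integral_nonneg[OF intab g0])
  moreover have "G 0 = 0" by (simp add: G_def)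
  ultimately obtain m where m: "0 \<le> m" "m \<le> h" "G m = G h / 2"
    using IVT'[of G 0 "G h / 2" h] \<open>0 < h\<close> by auto
  have mh: "integral {m..h} g = G h / 2"
    using Henstock_Kurzweil_Integration.integral_combine[OF m(1,2) intab] m by (simp add: G_def)
  have nn2: "(\<integral>\<^sup>+y. (if m \<le> y \<and> y < h then f y else 0) \<partial>lborel) = ennreal (integral {m..h} g)"
  proof -
    have "(\<integral>\<^sup>+y. (if m \<le> y \<and> y < h then f y else 0) \<partial>lborel) = (\<integral>\<^sup>+y. (if m < y \<and> y < h then f y else 0) \<partial>lborel)"
    proof (rule nn_integral_cong_AE)
      show "AE y in lborel. (if m \<le> y \<and> y < h then f y else 0) = (if m < y \<and> y < h then f y else 0)"
        using AE_lborel_singleton[of m] by eventually_elim auto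
    qed
    also have "\<dots> = ennreal (integral {m..h} g)" using m by (intro nn) auto
    finally show ?thesis .
  qed
  have two: "2 * ennreal (x / 2) = ennreal x" if "0 \<le> x" for x
    using that ennreal_mult[of 2 "x/2"] by simp
  show ?thesis
    using nn2 mh m Gm[of m] Gm[of h] \<open>0 \<le> G h\<close> \<open>0 < h\<close> two[of "G h"] by (metis that less_imp_le order_refl)
qed

text \<open>For a smooth primitive F with F(0) = 0 one has F(h)^(n+1) = (n+1) times the integral of
  f F^n. The median m gives a weaker constant directly: beyond m, F is at least F(h)/2 and half of
  the mass remains, so each of the n+1 factors costs a factor 2.\<close>

lemma initial_mass_power_le:
  assumes [measurable]: "f \<in> borel_measurable borel" and fin: "initial_mass f h < \<infinity>"
  shows "initial_mass f h ^ Suc n \<le> 2 ^ Suc n * (\<integral>\<^sup>+y. (if 0 < y \<and> y < h then f y * initial_mass f y ^ n else 0) \<partial>lborel)"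
proof (cases "0 < h")
  case False
  then have "initial_mass f h = 0"
    unfolding initial_mass_def by (subst nn_integral_0_iff_AE) (auto intro!: AE_I2)
  then show ?thesis by simp
next
  case True
  then obtain m where m: "0 \<le> m" "m \<le> h" "2 * initial_mass f m = initial_mass f h"
    "2 * (\<integral>\<^sup>+y. (if m \<le> y \<and> y < h then f y else 0) \<partial>lborel) = initial_mass f h"
    using initial_mass_median[OF assms] by metis
  have "initial_mass f h ^ Suc n
      = 2 * (\<integral>\<^sup>+y. (if m \<le> y \<and> y < h then f y else 0) \<partial>lborel) * (2 * initial_mass f m) ^ n"
    using m(3,4) by simp
  also have "\<dots> = 2 ^ Suc n * (\<integral>\<^sup>+y. (if m \<le> y \<and> y < h then f y else 0) * initial_mass f m ^ n \<partial>lborel)"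
    by (subst nn_integral_multc) (simp_all add: power_mult_distrib ac_simps)
  also have "\<dots> \<le> 2 ^ Suc n * (\<integral>\<^sup>+y. (if 0 < y \<and> y < h then f y * initial_mass f y ^ n else 0) \<partial>lborel)"
  proof (intro mult_left_mono nn_integral_mono_AE)
    show "AE y in lborel. (if m \<le> y \<and> y < h then f y else 0) * initial_mass f m ^ n
      \<le> (if 0 < y \<and> y < h then f y * initial_mass f y ^ n else 0)"
      using AE_lborel_singleton[of 0]
      by eventually_elim (use m(1) in \<open>auto intro!: mult_left_mono power_mono initial_mass_mono\<close>)
  qed simp
  finally show ?thesis .
qed

lemma nn_integral_inverse_power_tail:
  assumes "0 < n" "0 < (y::real)"
  shows "(\<integral>\<^sup>+h. (if y < h then ennreal (1 / h ^ Suc n) else 0) \<partial>lborel) \<le> ennreal (1 / y ^ n)"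
proof -
  have "(\<integral>\<^sup>+h. (if y < h then ennreal (1 / h ^ Suc n) else 0) \<partial>lborel)
      \<le> (\<integral>\<^sup>+h. indicator {y..} h * ennreal (1 / h ^ Suc n) \<partial>lborel)"
    by (intro nn_integral_mono) (auto simp: indicator_def)
  also have "\<dots> = ennreal (1 / (real n * y ^ n))"
  proof (rule nn_integral_indicator_has_integral)
    show "((\<lambda>h. 1 / h ^ Suc n) has_integral 1 / (real n * y ^ n)) {y..}"
      using has_integral_inverse_power_to_inf[of "Suc n" y] assms by (simp del: power_Suc)
  qed (use assms in auto)
  also have "\<dots> \<le> ennreal (1 / y ^ n)"
  proof (intro ennreal_leI divide_left_mono)
    show "y ^ n \<le> real n * y ^ n"
      using assms mult_right_mono[of 1 "real n" "y ^ n"] by simp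
  qed (use assms in auto)
  finally show ?thesis .
qed

definition initial_average :: "(real \<Rightarrow> ennreal) \<Rightarrow> real \<Rightarrow> ennreal" where
  "initial_average f h = initial_mass f h * ennreal (1 / h)"

lemma measurable_initial_average [measurable]:
  assumes [measurable]: "f \<in> borel_measurable borel"
  shows "initial_average f \<in> borel_measurable borel"
  unfolding initial_average_def[abs_def] by measurable

text \<open>Trades one factor of the average for the value of f at the moving endpoint: after
  \<open>initial_mass_power_le\<close> and exchanging the integrals, the tail integral of 1/h^(n+1)
  from y supplies, up to 1/n <= 1, the 1/y^n that turns the n remaining masses into
  averages.\<close>

lemma nn_integral_initial_average_power_le:
  assumes [measurable]: "f \<in> borel_measurable borel" and fin: "\<And>h. initial_mass f h < \<infinity>" and "0 < n"
  shows "(\<integral>\<^sup>+h. (if 0 < h then initial_average f h ^ Suc n else 0) \<partial>lborel)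
    \<le> 2 ^ Suc n * (\<integral>\<^sup>+h. (if 0 < h then f h * initial_average f h ^ n else 0) \<partial>lborel)"
proof -
  have "(\<integral>\<^sup>+h. (if 0 < h then initial_average f h ^ Suc n else 0) \<partial>lborel)
     \<le> (\<integral>\<^sup>+h. \<integral>\<^sup>+y. 2 ^ Suc n * (if 0 < y \<and> y < h then f y * initial_mass f y ^ n * ennreal (1 / h ^ Suc n) else 0) \<partial>lborel \<partial>lborel)"
  proof (intro nn_integral_mono)
    fix h :: real
    show "(if 0 < h then initial_average f h ^ Suc n else 0)
       \<le> (\<integral>\<^sup>+y. 2 ^ Suc n * (if 0 < y \<and> y < h then f y * initial_mass f y ^ n * ennreal (1 / h ^ Suc n) else 0) \<partial>lborel)"
    proof (cases "0 < h")
      case True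
      have "initial_average f h ^ Suc n = initial_mass f h ^ Suc n * ennreal (1 / h ^ Suc n)"
        unfolding initial_average_def power_mult_distrib using True
        by (simp add: ennreal_power power_divide del: power_Suc)
      also have "\<dots> \<le> (2 ^ Suc n * (\<integral>\<^sup>+y. (if 0 < y \<and> y < h then f y * initial_mass f y ^ n else 0) \<partial>lborel)) * ennreal (1 / h ^ Suc n)"
        by (intro mult_right_mono initial_mass_power_le fin) auto
      also have "\<dots> = 2 ^ Suc n * (\<integral>\<^sup>+y. (if 0 < y \<and> y < h then f y * initial_mass f y ^ n else 0) * ennreal (1 / h ^ Suc n) \<partial>lborel)"
        by (subst nn_integral_multc) (simp_all add: mult.assoc del: power_Suc)
      also have "\<dots> = (\<integral>\<^sup>+y. 2 ^ Suc n * (if 0 < y \<and> y < h then f y * initial_mass f y ^ n * ennreal (1 / h ^ Suc n) else 0) \<partial>lborel)"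
        by (subst nn_integral_cmult[symmetric]) (auto intro!: nn_integral_cong simp del: power_Suc)
      finally show ?thesis using True by (simp del: power_Suc)
    qed auto
  qed
  also have "\<dots> = (\<integral>\<^sup>+y. \<integral>\<^sup>+h. 2 ^ Suc n * (if 0 < y \<and> y < h then f y * initial_mass f y ^ n * ennreal (1 / h ^ Suc n) else 0) \<partial>lborel \<partial>lborel)"
    by (rule lborel_pair.Fubini') measurable
  also have "\<dots> \<le> (\<integral>\<^sup>+y. 2 ^ Suc n * (if 0 < y then f y * initial_average f y ^ n else 0) \<partial>lborel)"
  proof (intro nn_integral_mono)
    fix y :: real
    show "(\<integral>\<^sup>+h. 2 ^ Suc n * (if 0 < y \<and> y < h then f y * initial_mass f y ^ n * ennreal (1 / h ^ Suc n) else 0) \<partial>lborel)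
      \<le> 2 ^ Suc n * (if 0 < y then f y * initial_average f y ^ n else 0)"
    proof (cases "0 < y")
      case True
      have "(\<integral>\<^sup>+h. 2 ^ Suc n * (if 0 < y \<and> y < h then f y * initial_mass f y ^ n * ennreal (1 / h ^ Suc n) else 0) \<partial>lborel)
        = (\<integral>\<^sup>+h. (2 ^ Suc n * (f y * initial_mass f y ^ n)) * (if y < h then ennreal (1 / h ^ Suc n) else 0) \<partial>lborel)"
        using True by (intro nn_integral_cong) (auto simp: mult.assoc simp del: power_Suc)
      also have "\<dots> = (2 ^ Suc n * (f y * initial_mass f y ^ n)) * (\<integral>\<^sup>+h. (if y < h then ennreal (1 / h ^ Suc n) else 0) \<partial>lborel)"
        by (rule nn_integral_cmult) measurable
      also have "\<dots> \<le> (2 ^ Suc n * (f y * initial_mass f y ^ n)) * ennreal (1 / y ^ n)"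
        by (intro mult_left_mono nn_integral_inverse_power_tail True \<open>0 < n\<close>) auto
      also have "\<dots> = 2 ^ Suc n * (f y * initial_average f y ^ n)"
        using True by (simp add: initial_average_def power_mult_distrib ennreal_power power_divide mult.assoc del: power_Suc)
      finally show ?thesis using True by (simp del: power_Suc)
    qed auto
  qed
  also have "\<dots> = 2 ^ Suc n * (\<integral>\<^sup>+h. (if 0 < h then f h * initial_average f h ^ n else 0) \<partial>lborel)"
    by (rule nn_integral_cmult) measurable
  finally show ?thesis .
qed

text \<open>Schur's test with the weight $y^{1/2}$.\<close>

lemma initial_mass_square_le:
  assumes [measurable]: "f \<in> borel_measurable borel" and "0 < h"
  shows "(initial_mass f h)\<^sup>2 \<le> ennreal (2 * h powr (1/2)) * (\<integral>\<^sup>+y. (if 0 < y \<and> y < h then (f y)\<^sup>2 * ennreal (y powr (1/2)) else 0) \<partial>lborel)"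
proof -
  \<comment> \<open>Splits 1 as y^(-1/4) y^(1/4): the square y^(-1/2) of the first factor is
    integrable at 0, with integral 2 h^(1/2) over (0,h).\<close>
  define w where "w y = (if 0 < y \<and> y < h then ennreal (y powr (-1/4)) else 0)" for y
  define F where "F y = (if 0 < y \<and> y < h then f y * ennreal (y powr (1/4)) else 0)" for y
  have [measurable]: "w \<in> borel_measurable borel" "F \<in> borel_measurable borel"
    unfolding w_def[abs_def] F_def[abs_def] by measurable
  have "initial_mass f h = (\<integral>\<^sup>+y. w y * F y \<partial>lborel)"
    unfolding initial_mass_def
  proof (intro nn_integral_cong)
    fix y :: real
    have "ennreal (y powr (-1/4)) * ennreal (y powr (1/4)) = 1" if "0 < y"
      using that by (simp add: ennreal_mult[symmetric] powr_add[symmetric])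
    then show "(if 0 < y \<and> y < h then f y else 0) = w y * F y"
      by (auto simp: w_def F_def mult.left_commute[of _ "f y"])
  qed
  then have "(initial_mass f h)\<^sup>2 \<le> (\<integral>\<^sup>+y. (w y)\<^sup>2 \<partial>lborel) * (\<integral>\<^sup>+y. (F y)\<^sup>2 \<partial>lborel)"
    using nn_integral_Cauchy_Schwarz[of w lborel F] by simp
  also have "(\<integral>\<^sup>+y. (F y)\<^sup>2 \<partial>lborel) = (\<integral>\<^sup>+y. (if 0 < y \<and> y < h then (f y)\<^sup>2 * ennreal (y powr (1/2)) else 0) \<partial>lborel)"
  proof (intro nn_integral_cong)
    fix y :: real
    have "(ennreal (y powr (1/4)))\<^sup>2 = ennreal (y powr (1/2))"
      by (simp add: power2_eq_square ennreal_mult[symmetric] powr_add[symmetric])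
    then show "(F y)\<^sup>2 = (if 0 < y \<and> y < h then (f y)\<^sup>2 * ennreal (y powr (1/2)) else 0)"
      by (simp add: F_def power_mult_distrib)
  qed
  also have "(\<integral>\<^sup>+y. (w y)\<^sup>2 \<partial>lborel) \<le> (\<integral>\<^sup>+y. indicator {0..h} y * ennreal (y powr (-1/2)) \<partial>lborel)"
    by (intro nn_integral_mono) (auto simp: w_def power2_eq_square ennreal_mult[symmetric] powr_add[symmetric])
  also have "\<dots> = ennreal (2 * h powr (1/2))"
    using has_integral_powr_from_0[of "-1/2" h] \<open>0 < h\<close>
    by (intro nn_integral_indicator_has_integral) (auto simp: mult.commute)
  finally show ?thesis
    by (simp add: mult_right_mono)
qed

text \<open>Dividing the bound of \<open>initial_mass_square_le\<close> by h^2 leaves h^(-3/2),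
  whose tail integral from y is a multiple of y^(-1/2) and cancels the weight y^(1/2). The constant
  4 is the classical (p/(p-1))^p for p = 2.\<close>

theorem Hardy_inequality:
  assumes [measurable]: "f \<in> borel_measurable borel"
  shows "(\<integral>\<^sup>+h. (if 0 < h then (initial_average f h)\<^sup>2 else 0) \<partial>lborel) \<le> 4 * (\<integral>\<^sup>+h. (f h)\<^sup>2 \<partial>lborel)"
proof -
  have "(\<integral>\<^sup>+h. (if 0 < h then (initial_average f h)\<^sup>2 else 0) \<partial>lborel)
     \<le> (\<integral>\<^sup>+h. \<integral>\<^sup>+y. (if 0 < y \<and> y < h then (f y)\<^sup>2 * ennreal (y powr (1/2)) * ennreal (2 * h powr (-3/2)) else 0) \<partial>lborel \<partial>lborel)"
  proof (intro nn_integral_mono)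
    fix h :: real
    show "(if 0 < h then (initial_average f h)\<^sup>2 else 0)
      \<le> (\<integral>\<^sup>+y. (if 0 < y \<and> y < h then (f y)\<^sup>2 * ennreal (y powr (1/2)) * ennreal (2 * h powr (-3/2)) else 0) \<partial>lborel)"
    proof (cases "0 < h")
      case True
      let ?I = "\<integral>\<^sup>+y. (if 0 < y \<and> y < h then (f y)\<^sup>2 * ennreal (y powr (1/2)) else 0) \<partial>lborel"
      have e: "2 * h powr (1/2) * (1/h)\<^sup>2 = 2 * h powr (-3/2)"
      proof -
        have "(1/h)\<^sup>2 = h powr (-2)"
          using True by (simp add: powr_minus_divide power_divide powr_numeral)
        then show ?thesis using True by (simp add: powr_add[symmetric])
      qed
      have "(initial_average f h)\<^sup>2 \<le> (ennreal (2 * h powr (1/2)) * ?I) * (ennreal (1/h))\<^sup>2"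
        unfolding initial_average_def power_mult_distrib
        by (intro mult_right_mono initial_mass_square_le True) auto
      also have "\<dots> = (ennreal (2 * h powr (1/2)) * ennreal ((1/h)\<^sup>2)) * ?I"
        using True by (simp add: ennreal_power ac_simps)
      also have "\<dots> = ennreal (2 * h powr (-3/2)) * ?I"
        using True by (subst ennreal_mult[symmetric]) (auto simp: e)
      also have "\<dots> = (\<integral>\<^sup>+y. (if 0 < y \<and> y < h then (f y)\<^sup>2 * ennreal (y powr (1/2)) * ennreal (2 * h powr (-3/2)) else 0) \<partial>lborel)"
        by (subst nn_integral_cmult[symmetric]) (auto intro!: nn_integral_cong simp: mult.commute)
      finally show ?thesis using True by simp
    qed auto
  qed
  also have "\<dots> = (\<integral>\<^sup>+y. \<integral>\<^sup>+h. (if 0 < y \<and> y < h then (f y)\<^sup>2 * ennreal (y powr (1/2)) * ennreal (2 * h powr (-3/2)) else 0) \<partial>lborel \<partial>lborel)"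
    by (rule lborel_pair.Fubini') measurable
  also have "\<dots> \<le> (\<integral>\<^sup>+y. 4 * (f y)\<^sup>2 \<partial>lborel)"
  proof (intro nn_integral_mono)
    fix y :: real
    show "(\<integral>\<^sup>+h. (if 0 < y \<and> y < h then (f y)\<^sup>2 * ennreal (y powr (1/2)) * ennreal (2 * h powr (-3/2)) else 0) \<partial>lborel) \<le> 4 * (f y)\<^sup>2"
    proof (cases "0 < y")
      case True
      have "(\<integral>\<^sup>+h. (if 0 < y \<and> y < h then (f y)\<^sup>2 * ennreal (y powr (1/2)) * ennreal (2 * h powr (-3/2)) else 0) \<partial>lborel)
        \<le> (\<integral>\<^sup>+h. ((f y)\<^sup>2 * ennreal (y powr (1/2))) * (indicator {y..} h * ennreal (2 * h powr (-3/2))) \<partial>lborel)"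
        by (intro nn_integral_mono) (auto simp: indicator_def)
      also have "\<dots> = ((f y)\<^sup>2 * ennreal (y powr (1/2))) * (\<integral>\<^sup>+h. indicator {y..} h * ennreal (2 * h powr (-3/2)) \<partial>lborel)"
        by (rule nn_integral_cmult) measurable
      also have "(\<integral>\<^sup>+h. indicator {y..} h * ennreal (2 * h powr (-3/2)) \<partial>lborel) = ennreal (4 * y powr (-1/2))"
      proof (rule nn_integral_indicator_has_integral)
        show "((\<lambda>h. 2 * h powr (-3/2)) has_integral 4 * y powr (-1/2)) {y..}"
          using has_integral_mult_right[OF has_integral_powr_to_inf[of "-3/2" y], of 2] True by simp
      qed auto
      also have "(f y)\<^sup>2 * ennreal (y powr (1/2)) * ennreal (4 * y powr (-1/2)) = 4 * (f y)\<^sup>2"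
      proof -
        have "y powr (1/2) * (4 * y powr (-1/2)) = 4"
          using True by (simp add: powr_add[symmetric])
        then have "ennreal (y powr (1/2)) * ennreal (4 * y powr (-1/2)) = 4"
          by (metis ennreal_mult ennreal_numeral powr_ge_zero mult_nonneg_nonneg zero_le_numeral)
        then show ?thesis by (metis mult.assoc mult.commute)
      qed
      finally show ?thesis .
    qed auto
  qed
  also have "\<dots> = 4 * (\<integral>\<^sup>+h. (f h)\<^sup>2 \<partial>lborel)"
    by (rule nn_integral_cmult) measurable
  finally show ?thesis .
qed

text \<open>Substituting h - y for y: looking left from b and looking right from b - h see the same
  interval. Estimates anchored at one endpoint thus apply at either end.\<close>

lemma initial_mass_eq_shift_reflect:
  assumes [measurable]: "f \<in> borel_measurable borel"
  shows "initial_mass (\<lambda>y. f (b - y)) h = initial_mass (\<lambda>y. f (b - h + y)) h"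
proof -
  have "initial_mass (\<lambda>y. f (b - y)) h
      = \<bar>-1::real\<bar> * (\<integral>\<^sup>+y. (if 0 < h + (-1) * y \<and> h + (-1) * y < h then f (b - (h + (-1) * y)) else 0) \<partial>lborel)"
    unfolding initial_mass_def by (rule nn_integral_real_affine) auto
  also have "\<dots> = initial_mass (\<lambda>y. f (b - h + y)) h"
    unfolding initial_mass_def by (auto intro!: nn_integral_cong simp: algebra_simps)
  finally show ?thesis .
qed

text \<open>Peeling off one factor \<open>f\<close> at the right and one at the left endpoint of $[a,a+h]$ leaves two
  factors $f(a)f(a+h)$ and the square of the average; Young's inequality and Hardy's inequality at
  either endpoint then suffice, without a maximal function.\<close>

theorem nn_integral_average_power4_le:
  fixes f :: "real \<Rightarrow> ennreal"
  assumes [measurable]: "f \<in> borel_measurable borel" and fin: "(\<integral>\<^sup>+x. f x \<partial>lborel) < \<infinity>"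
  shows "(\<integral>\<^sup>+a. \<integral>\<^sup>+h. (if 0 < h then initial_average (\<lambda>y. f (a + y)) h ^ 4 else 0) \<partial>lborel \<partial>lborel)
    \<le> 1024 * (\<integral>\<^sup>+x. (f x)\<^sup>2 \<partial>lborel)\<^sup>2" (is "?L \<le> 1024 * ?S\<^sup>2")
proof -
  have affine: "(\<integral>\<^sup>+x. g (t + x) \<partial>lborel) = (\<integral>\<^sup>+x. g x \<partial>lborel)"
    "(\<integral>\<^sup>+x. g (t - x) \<partial>lborel) = (\<integral>\<^sup>+x. g x \<partial>lborel)"
    if [measurable]: "g \<in> borel_measurable borel" for g :: "real \<Rightarrow> ennreal" and t
    using nn_integral_real_affine[of g 1 t] nn_integral_real_affine[of g "-1" t] that by simp_all
  have lm_le: "initial_mass g h \<le> (\<integral>\<^sup>+x. g x \<partial>lborel)" for g h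
    unfolding initial_mass_def by (intro nn_integral_mono) auto
  have fin1: "initial_mass (\<lambda>y. f (a + y)) h < \<infinity>" for a h
    using lm_le[of "\<lambda>y. f (a + y)" h] fin by (simp add: affine)
  have fin2: "initial_mass (\<lambda>y. f (a - y)) h < \<infinity>" for a h
    using lm_le[of "\<lambda>y. f (a - y)" h] fin by (simp add: affine)
  define U where "U a h = initial_average (\<lambda>y. f (a + y)) h" for a h
  have [measurable]: "case_prod U \<in> borel_measurable (borel \<Otimes>\<^sub>M borel)"
    unfolding U_def initial_average_def initial_mass_def by measurable
  have U_reflect: "initial_average (\<lambda>y. f (b - y)) h = U (b - h) h" for b h
    by (simp add: U_def initial_average_def initial_mass_eq_shift_reflect)
  \<comment> \<open>Translating by h, for fixed h, moves the anchor: the outer variable becomes the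
    right endpoint b = a + h.\<close>
  have shift: "(\<integral>\<^sup>+a. \<integral>\<^sup>+h. G a h \<partial>lborel \<partial>lborel) = (\<integral>\<^sup>+b. \<integral>\<^sup>+h. G (b - h) h \<partial>lborel \<partial>lborel)"
    if [measurable]: "case_prod G \<in> borel_measurable (borel \<Otimes>\<^sub>M borel)" for G :: "real \<Rightarrow> real \<Rightarrow> ennreal"
  proof -
    have "(\<integral>\<^sup>+a. \<integral>\<^sup>+h. G a h \<partial>lborel \<partial>lborel) = (\<integral>\<^sup>+h. \<integral>\<^sup>+a. G a h \<partial>lborel \<partial>lborel)"
      by (rule lborel_pair.Fubini') measurable
    also have "\<dots> = (\<integral>\<^sup>+h. \<integral>\<^sup>+b. G (b - h) h \<partial>lborel \<partial>lborel)"
      using affine(1)[of "\<lambda>a. G a h" "- h" for h] by simp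
    also have "\<dots> = (\<integral>\<^sup>+b. \<integral>\<^sup>+h. G (b - h) h \<partial>lborel \<partial>lborel)"
      by (rule lborel_pair.Fubini') measurable
    finally show ?thesis .
  qed
  \<comment> \<open>First exchange, left endpoint a fixed: one of the four averages becomes f(a+h),
    at cost 2^4.\<close>
  have "?L \<le> (\<integral>\<^sup>+a. 2 ^ 4 * (\<integral>\<^sup>+h. (if 0 < h then f (a + h) * U a h ^ 3 else 0) \<partial>lborel) \<partial>lborel)"
  proof (intro nn_integral_mono)
    fix a
    show "(\<integral>\<^sup>+h. (if 0 < h then initial_average (\<lambda>y. f (a + y)) h ^ 4 else 0) \<partial>lborel)
      \<le> 2 ^ 4 * (\<integral>\<^sup>+h. (if 0 < h then f (a + h) * U a h ^ 3 else 0) \<partial>lborel)"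
      using nn_integral_initial_average_power_le[OF _ fin1[of a], of 3, simplified Suc_numeral semiring_norm]
      unfolding U_def by simp
  qed
  also have "\<dots> = 2 ^ 4 * (\<integral>\<^sup>+a. \<integral>\<^sup>+h. (if 0 < h then f (a + h) * U a h ^ 3 else 0) \<partial>lborel \<partial>lborel)"
    by (rule nn_integral_cmult) measurable
  also have "(\<integral>\<^sup>+a. \<integral>\<^sup>+h. (if 0 < h then f (a + h) * U a h ^ 3 else 0) \<partial>lborel \<partial>lborel)
     = (\<integral>\<^sup>+b. \<integral>\<^sup>+h. (if 0 < h then f (b - h + h) * U (b - h) h ^ 3 else 0) \<partial>lborel \<partial>lborel)"
    by (rule shift) measurable
  also have "\<dots> = (\<integral>\<^sup>+b. f b * (\<integral>\<^sup>+h. (if 0 < h then U (b - h) h ^ 3 else 0) \<partial>lborel) \<partial>lborel)"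
    by (intro nn_integral_cong, subst nn_integral_cmult[symmetric]) (auto intro!: nn_integral_cong)
  \<comment> \<open>Second exchange, right endpoint b fixed: one of the three remaining averages
    becomes f(b-h), at cost 2^3.\<close>
  also have "\<dots> \<le> (\<integral>\<^sup>+b. f b * (2 ^ 3 * (\<integral>\<^sup>+h. (if 0 < h then f (b - h) * (U (b - h) h)\<^sup>2 else 0) \<partial>lborel)) \<partial>lborel)"
  proof (intro nn_integral_mono mult_left_mono)
    fix b
    show "(\<integral>\<^sup>+h. (if 0 < h then U (b - h) h ^ 3 else 0) \<partial>lborel)
      \<le> 2 ^ 3 * (\<integral>\<^sup>+h. (if 0 < h then f (b - h) * (U (b - h) h)\<^sup>2 else 0) \<partial>lborel)"
      using nn_integral_initial_average_power_le[OF _ fin2[of b], of 2, simplified Suc_numeral semiring_norm]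
      unfolding U_reflect by simp
  qed simp
  \<comment> \<open>The cost 2^3 is written as 4 times 2 because Young's inequality absorbs the
    2.\<close>
  also have "\<dots> = (\<integral>\<^sup>+b. \<integral>\<^sup>+h. (if 0 < h then 4 * (2 * (f b * f (b - h))) * (U (b - h) h)\<^sup>2 else 0) \<partial>lborel \<partial>lborel)"
  proof (intro nn_integral_cong)
    fix b
    have "(\<integral>\<^sup>+h. (if 0 < h then 4 * (2 * (f b * f (b - h))) * (U (b - h) h)\<^sup>2 else 0) \<partial>lborel)
      = (\<integral>\<^sup>+h. (f b * 2 ^ 3) * (if 0 < h then f (b - h) * (U (b - h) h)\<^sup>2 else 0) \<partial>lborel)"
    proof (intro nn_integral_cong)
      fix h
      have "4 * (2 * (f b * f (b - h))) * (U (b - h) h)\<^sup>2 = (4 * 2) * (f b * f (b - h) * (U (b - h) h)\<^sup>2)"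
        by (simp only: mult.assoc)
      also have "\<dots> = 2 ^ 3 * (f b * f (b - h) * (U (b - h) h)\<^sup>2)" by simp
      also have "\<dots> = (f b * 2 ^ 3) * (f (b - h) * (U (b - h) h)\<^sup>2)" by (simp only: ac_simps)
      finally show "(if 0 < h then 4 * (2 * (f b * f (b - h))) * (U (b - h) h)\<^sup>2 else 0)
        = (f b * 2 ^ 3) * (if 0 < h then f (b - h) * (U (b - h) h)\<^sup>2 else 0)"
        by auto
    qed
    also have "\<dots> = (f b * 2 ^ 3) * (\<integral>\<^sup>+h. (if 0 < h then f (b - h) * (U (b - h) h)\<^sup>2 else 0) \<partial>lborel)"
      by (rule nn_integral_cmult) measurable
    finally show "f b * (2 ^ 3 * (\<integral>\<^sup>+h. (if 0 < h then f (b - h) * (U (b - h) h)\<^sup>2 else 0) \<partial>lborel))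
      = (\<integral>\<^sup>+h. (if 0 < h then 4 * (2 * (f b * f (b - h))) * (U (b - h) h)\<^sup>2 else 0) \<partial>lborel)"
      by (simp only: mult.assoc)
  qed
  also have "\<dots> \<le> (\<integral>\<^sup>+b. \<integral>\<^sup>+h. (if 0 < h then 4 * (f b)\<^sup>2 * (U (b - h) h)\<^sup>2 else 0)
       + (if 0 < h then 4 * (f (b - h))\<^sup>2 * (U (b - h) h)\<^sup>2 else 0) \<partial>lborel \<partial>lborel)"
  proof (intro nn_integral_mono)
    fix b h
    have "4 * (2 * (f b * f (b - h))) * (U (b - h) h)\<^sup>2 \<le> 4 * ((f b)\<^sup>2 + (f (b - h))\<^sup>2) * (U (b - h) h)\<^sup>2"
      by (intro mult_left_mono mult_right_mono two_mult_le_sum_squares_ennreal) auto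
    also have "\<dots> = 4 * (f b)\<^sup>2 * (U (b - h) h)\<^sup>2 + 4 * (f (b - h))\<^sup>2 * (U (b - h) h)\<^sup>2"
      by (simp only: distrib_left distrib_right)
    finally show "(if 0 < h then 4 * (2 * (f b * f (b - h))) * (U (b - h) h)\<^sup>2 else 0)
      \<le> (if 0 < h then 4 * (f b)\<^sup>2 * (U (b - h) h)\<^sup>2 else 0)
       + (if 0 < h then 4 * (f (b - h))\<^sup>2 * (U (b - h) h)\<^sup>2 else 0)" by auto
  qed
  also have "\<dots> = (\<integral>\<^sup>+b. \<integral>\<^sup>+h. (if 0 < h then 4 * (f b)\<^sup>2 * (U (b - h) h)\<^sup>2 else 0) \<partial>lborel \<partial>lborel)
       + (\<integral>\<^sup>+b. \<integral>\<^sup>+h. (if 0 < h then 4 * (f (b - h))\<^sup>2 * (U (b - h) h)\<^sup>2 else 0) \<partial>lborel \<partial>lborel)"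
  proof -
    have "(\<integral>\<^sup>+h. (if 0 < h then 4 * (f b)\<^sup>2 * (U (b - h) h)\<^sup>2 else 0)
        + (if 0 < h then 4 * (f (b - h))\<^sup>2 * (U (b - h) h)\<^sup>2 else 0) \<partial>lborel)
      = (\<integral>\<^sup>+h. (if 0 < h then 4 * (f b)\<^sup>2 * (U (b - h) h)\<^sup>2 else 0) \<partial>lborel)
        + (\<integral>\<^sup>+h. (if 0 < h then 4 * (f (b - h))\<^sup>2 * (U (b - h) h)\<^sup>2 else 0) \<partial>lborel)" for b
      by (rule nn_integral_add) measurable
    then show ?thesis
      by (simp only:) (rule nn_integral_add; measurable)
  qed
  also have "(\<integral>\<^sup>+b. \<integral>\<^sup>+h. (if 0 < h then 4 * (f (b - h))\<^sup>2 * (U (b - h) h)\<^sup>2 else 0) \<partial>lborel \<partial>lborel)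
     = (\<integral>\<^sup>+a. \<integral>\<^sup>+h. (if 0 < h then 4 * (f a)\<^sup>2 * (U a h)\<^sup>2 else 0) \<partial>lborel \<partial>lborel)"
    by (rule shift[symmetric]) measurable
  also have "\<dots> \<le> (\<integral>\<^sup>+a. 4 * (f a)\<^sup>2 * (4 * ?S) \<partial>lborel)"
  proof (intro nn_integral_mono)
    fix a
    have "(\<integral>\<^sup>+h. (if 0 < h then 4 * (f a)\<^sup>2 * (U a h)\<^sup>2 else 0) \<partial>lborel)
      = 4 * (f a)\<^sup>2 * (\<integral>\<^sup>+h. (if 0 < h then (U a h)\<^sup>2 else 0) \<partial>lborel)"
      by (subst nn_integral_cmult[symmetric]) (auto intro!: nn_integral_cong)
    also have "\<dots> \<le> 4 * (f a)\<^sup>2 * (4 * ?S)"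
      using Hardy_inequality[of "\<lambda>y. f (a + y)"] affine(1)[of "\<lambda>y. (f y)\<^sup>2" a]
      unfolding U_def by (intro mult_left_mono) simp_all
    finally show "(\<integral>\<^sup>+h. (if 0 < h then 4 * (f a)\<^sup>2 * (U a h)\<^sup>2 else 0) \<partial>lborel) \<le> 4 * (f a)\<^sup>2 * (4 * ?S)" .
  qed
  also have "(\<integral>\<^sup>+b. \<integral>\<^sup>+h. (if 0 < h then 4 * (f b)\<^sup>2 * (U (b - h) h)\<^sup>2 else 0) \<partial>lborel \<partial>lborel)
     \<le> (\<integral>\<^sup>+a. 4 * (f a)\<^sup>2 * (4 * ?S) \<partial>lborel)"
  proof (intro nn_integral_mono)
    fix b
    have "(\<integral>\<^sup>+h. (if 0 < h then 4 * (f b)\<^sup>2 * (U (b - h) h)\<^sup>2 else 0) \<partial>lborel)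
      = 4 * (f b)\<^sup>2 * (\<integral>\<^sup>+h. (if 0 < h then (U (b - h) h)\<^sup>2 else 0) \<partial>lborel)"
      by (subst nn_integral_cmult[symmetric]) (auto intro!: nn_integral_cong)
    also have "\<dots> \<le> 4 * (f b)\<^sup>2 * (4 * ?S)"
      using Hardy_inequality[of "\<lambda>y. f (b - y)"] affine(2)[of "\<lambda>y. (f y)\<^sup>2" b]
      unfolding U_reflect by (intro mult_left_mono) simp_all
    finally show "(\<integral>\<^sup>+h. (if 0 < h then 4 * (f b)\<^sup>2 * (U (b - h) h)\<^sup>2 else 0) \<partial>lborel) \<le> 4 * (f b)\<^sup>2 * (4 * ?S)" .
  qed
  also have "(\<integral>\<^sup>+a. 4 * (f a)\<^sup>2 * (4 * ?S) \<partial>lborel) = 16 * ?S\<^sup>2"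
    by (subst nn_integral_multc, simp, subst nn_integral_cmult) (simp_all add: power2_eq_square ac_simps)
  finally have "?L \<le> 2 ^ 4 * (16 * ?S\<^sup>2 + 16 * ?S\<^sup>2)"
    by (simp add: mult_left_mono add_mono)
  \<comment> \<open>The two Hardy terms give 16 each and the first exchange a factor 16, hence 512;
    the stated constant has slack.\<close>
  also have "\<dots> \<le> 1024 * ?S\<^sup>2"
    by (simp add: distrib_right[symmetric] mult.assoc[symmetric] mult_right_mono)
  finally show ?thesis .
qed

section \<open>Square-integrable functions\<close>

definition L2 :: "'a measure \<Rightarrow> ('a \<Rightarrow> 'b::euclidean_space) \<Rightarrow> bool" where
  "L2 M f \<longleftrightarrow> f \<in> borel_measurable M \<and> integrable M (\<lambda>x. (norm (f x))\<^sup>2)"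

definition L2_sq :: "'a measure \<Rightarrow> ('a \<Rightarrow> 'b::euclidean_space) \<Rightarrow> real" where
  "L2_sq M f = (\<integral>x. (norm (f x))\<^sup>2 \<partial>M)"

lemma L2_measurable [measurable_dest]: "L2 M f \<Longrightarrow> f \<in> borel_measurable M"
  by (simp add: L2_def)

lemma L2_integrable_sq: "L2 M f \<Longrightarrow> integrable M (\<lambda>x. (norm (f x))\<^sup>2)"
  by (simp add: L2_def)

lemma L2_sq_nonneg: "0 \<le> L2_sq M f"
  by (simp add: L2_sq_def)

lemma L2_scaleR: "L2 M f \<Longrightarrow> L2 M (\<lambda>x. c *\<^sub>R f x)"
  by (auto simp: L2_def power_mult_distrib)

lemma norm_add_sq_le: "(norm (a + b))\<^sup>2 \<le> 2 * (norm a)\<^sup>2 + 2 * (norm (b::'b::real_inner))\<^sup>2"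
proof -
  have "(norm (a + b))\<^sup>2 + (norm (a - b))\<^sup>2 = 2 * (norm a)\<^sup>2 + 2 * (norm b)\<^sup>2"
    by (simp add: power2_norm_eq_inner inner_add inner_diff inner_commute algebra_simps)
  then show ?thesis
    using zero_le_power2[of "norm (a - b)"] by linarith
qed

lemma L2_add:
  assumes "L2 M f" "L2 M g"
  shows "L2 M (\<lambda>x. f x + g x)"
proof -
  have [measurable]: "f \<in> borel_measurable M" "g \<in> borel_measurable M"
    using assms by (auto simp: L2_def)
  have "integrable M (\<lambda>x. 2 * (norm (f x))\<^sup>2 + 2 * (norm (g x))\<^sup>2)"
    using assms by (auto simp: L2_def)
  then have "integrable M (\<lambda>x. (norm (f x + g x))\<^sup>2)"
    by (rule Bochner_Integration.integrable_bound) (auto intro!: AE_I2 norm_add_sq_le)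
  then show ?thesis by (simp add: L2_def)
qed

lemma L2_diff: "L2 M f \<Longrightarrow> L2 M g \<Longrightarrow> L2 M (\<lambda>x. f x - g x)"
  using L2_add[of M f "\<lambda>x. (-1) *\<^sub>R g x"] L2_scaleR[of M g "-1"] by simp

lemma L2_norm_mult_integrable:
  fixes f :: "'a \<Rightarrow> 'b::euclidean_space" and g :: "'a \<Rightarrow> 'c::euclidean_space"
  assumes "L2 M f" "L2 M g"
  shows "integrable M (\<lambda>x. norm (f x) * norm (g x))"
proof -
  have [measurable]: "f \<in> borel_measurable M" "g \<in> borel_measurable M"
    using assms by (auto simp: L2_def)
  have "integrable M (\<lambda>x. (norm (f x))\<^sup>2 + (norm (g x))\<^sup>2)"
    using assms by (auto simp: L2_def)
  then show ?thesis
  proof (rule Bochner_Integration.integrable_bound[OF _ _ AE_I2])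
    fix x
    have "2 * norm (f x) * norm (g x) \<le> (norm (f x))\<^sup>2 + (norm (g x))\<^sup>2" "0 \<le> norm (f x) * norm (g x)"
      by (rule sum_squares_bound) simp
    then have "norm (f x) * norm (g x) \<le> (norm (f x))\<^sup>2 + (norm (g x))\<^sup>2" by linarith
    then show "norm (norm (f x) * norm (g x)) \<le> norm ((norm (f x))\<^sup>2 + (norm (g x))\<^sup>2)" by simp
  qed measurable
qed

lemma L2_inner_integrable:
  assumes "L2 M f" "L2 M g"
  shows "integrable M (\<lambda>x. f x \<bullet> g x)"
proof -
  have [measurable]: "f \<in> borel_measurable M" "g \<in> borel_measurable M"
    using assms by (auto simp: L2_def)
  show ?thesis
    by (rule Bochner_Integration.integrable_bound[OF L2_norm_mult_integrable[OF assms]])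
       (auto intro!: AE_I2 simp: Cauchy_Schwarz_ineq2)
qed

lemma L2_Cauchy_Schwarz_norm:
  fixes f :: "'a \<Rightarrow> 'b::euclidean_space" and g :: "'a \<Rightarrow> 'c::euclidean_space"
  assumes "L2 M f" "L2 M g"
  shows "(\<integral>x. norm (f x) * norm (g x) \<partial>M) \<le> sqrt (L2_sq M f) * sqrt (L2_sq M g)"
proof -
  have [measurable]: "f \<in> borel_measurable M" "g \<in> borel_measurable M"
    using assms by (auto simp: L2_def)
  let ?I = "\<integral>x. norm (f x) * norm (g x) \<partial>M"
  have I0: "0 \<le> ?I" by simp
  have "(\<integral>\<^sup>+x. ennreal (norm (f x)) * ennreal (norm (g x)) \<partial>M)\<^sup>2
     \<le> (\<integral>\<^sup>+x. (ennreal (norm (f x)))\<^sup>2 \<partial>M) * (\<integral>\<^sup>+x. (ennreal (norm (g x)))\<^sup>2 \<partial>M)"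
    by (rule nn_integral_Cauchy_Schwarz) auto
  also have "(\<integral>\<^sup>+x. ennreal (norm (f x)) * ennreal (norm (g x)) \<partial>M) = ennreal ?I"
    using L2_norm_mult_integrable[OF assms]
    by (simp add: ennreal_mult[symmetric] nn_integral_eq_integral)
  also have "(\<integral>\<^sup>+x. (ennreal (norm (f x)))\<^sup>2 \<partial>M) = ennreal (L2_sq M f)"
    using assms unfolding L2_sq_def
    by (simp add: ennreal_power nn_integral_eq_integral L2_def)
  also have "(\<integral>\<^sup>+x. (ennreal (norm (g x)))\<^sup>2 \<partial>M) = ennreal (L2_sq M g)"
    using assms unfolding L2_sq_def
    by (simp add: ennreal_power nn_integral_eq_integral L2_def)
  finally have "?I\<^sup>2 \<le> L2_sq M f * L2_sq M g"
    using I0 L2_sq_nonneg[of M f] L2_sq_nonneg[of M g]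
    by (simp add: ennreal_power ennreal_mult[symmetric])
  then have "?I \<le> sqrt (L2_sq M f * L2_sq M g)"
    by (rule real_le_rsqrt)
  then show ?thesis by (simp add: real_sqrt_mult)
qed

lemma L2_Cauchy_Schwarz:
  assumes "L2 M f" "L2 M g"
  shows "\<bar>\<integral>x. f x \<bullet> g x \<partial>M\<bar> \<le> sqrt (L2_sq M f) * sqrt (L2_sq M g)"
proof -
  have "\<bar>\<integral>x. f x \<bullet> g x \<partial>M\<bar> \<le> (\<integral>x. \<bar>f x \<bullet> g x\<bar> \<partial>M)"
    by (rule integral_abs_bound)
  also have "\<dots> \<le> (\<integral>x. norm (f x) * norm (g x) \<partial>M)"
    using L2_inner_integrable[OF assms] L2_norm_mult_integrable[OF assms] by (intro integral_mono) (auto simp: Cauchy_Schwarz_ineq2)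
  also note L2_Cauchy_Schwarz_norm[OF assms]
  finally show ?thesis .
qed

text \<open>Stated with the midpoint, which stays in every convex constraint set: two elements with
  norms close to the infimum must then be close to each other.\<close>

lemma L2_sq_parallelogram:
  assumes "L2 M f" "L2 M g"
  shows "L2_sq M (\<lambda>x. f x - g x) = 2 * L2_sq M f + 2 * L2_sq M g - 4 * L2_sq M (\<lambda>x. (1/2) *\<^sub>R (f x + g x))"
proof -
  have "L2_sq M (\<lambda>x. f x - g x) = (\<integral>x. 2 * (norm (f x))\<^sup>2 + 2 * (norm (g x))\<^sup>2 - 4 * (norm ((1/2) *\<^sub>R (f x + g x)))\<^sup>2 \<partial>M)"
    unfolding L2_sq_def
    by (intro Bochner_Integration.integral_cong refl)
       (simp add: power2_norm_eq_inner inner_add inner_diff inner_commute algebra_simps)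
  also have "\<dots> = 2 * L2_sq M f + 2 * L2_sq M g - 4 * L2_sq M (\<lambda>x. (1/2) *\<^sub>R (f x + g x))"
    using L2_integrable_sq[OF assms(1)] L2_integrable_sq[OF assms(2)]
      L2_integrable_sq[OF L2_scaleR[OF L2_add[OF assms], of "1/2"]]
    unfolding L2_sq_def by simp
  finally show ?thesis .
qed

lemma L2_sq_add_le:
  assumes "L2 M f" "L2 M g"
  shows "sqrt (L2_sq M (\<lambda>x. f x + g x)) \<le> sqrt (L2_sq M f) + sqrt (L2_sq M g)"
proof (rule real_le_lsqrt)
  have "L2_sq M (\<lambda>x. f x + g x) = (\<integral>x. (norm (f x))\<^sup>2 + (norm (g x))\<^sup>2 + 2 * (f x \<bullet> g x) \<partial>M)"
    unfolding L2_sq_def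
    by (intro Bochner_Integration.integral_cong refl)
       (simp add: power2_norm_eq_inner inner_add inner_commute algebra_simps)
  also have "\<dots> = L2_sq M f + L2_sq M g + 2 * (\<integral>x. f x \<bullet> g x \<partial>M)"
    using L2_integrable_sq[OF assms(1)] L2_integrable_sq[OF assms(2)] L2_inner_integrable[OF assms]
    unfolding L2_sq_def by simp
  also have "\<dots> \<le> L2_sq M f + L2_sq M g + 2 * (sqrt (L2_sq M f) * sqrt (L2_sq M g))"
    using L2_Cauchy_Schwarz[OF assms] by linarith
  also have "\<dots> = (sqrt (L2_sq M f) + sqrt (L2_sq M g))\<^sup>2"
    by (simp add: power2_sum L2_sq_nonneg)
  finally show "L2_sq M (\<lambda>x. f x + g x) \<le> (sqrt (L2_sq M f) + sqrt (L2_sq M g))\<^sup>2" .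
qed (simp_all add: L2_sq_nonneg)

text \<open>Riesz-Fischer in a form that keeps the rate: the bound \<open>e n\<close> passes to the
  limit by Fatou's lemma. Finiteness of the measure turns L2 smallness of consecutive differences
  into summable L1 norms, hence into almost everywhere convergence along a subsequence.\<close>

lemma (in finite_measure) L2_complete:
  fixes h :: "nat \<Rightarrow> 'a \<Rightarrow> 'b::euclidean_space"
  assumes h: "\<And>n. L2 M (h n)"
    and le: "\<And>n m. n \<le> m \<Longrightarrow> L2_sq M (\<lambda>x. h n x - h m x) \<le> e n"
    and e: "e \<longlonglongrightarrow> 0"
  obtains g where "L2 M g" "\<And>n. L2_sq M (\<lambda>x. h n x - g x) \<le> e n"
proof -
  have [measurable]: "h n \<in> borel_measurable M" for n
    using h by (simp add: L2_def)
  have "\<exists>N. \<forall>n\<ge>N. e n \<le> (1/4) ^ k" for k :: nat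
    using order_tendstoD(2)[OF e, of "(1/4) ^ k"]
    unfolding eventually_sequentially by (auto intro: less_imp_le)
  then obtain N where N: "\<And>k n. N k \<le> n \<Longrightarrow> e n \<le> (1/4) ^ k" by metis
  \<comment> \<open>Summing all \<open>N i\<close> makes \<open>r\<close> monotone as well as at
    least \<open>N k\<close>; the added k makes it unbounded.\<close>
  define r where "r k = (\<Sum>i\<le>k. N i) + k" for k
  have rN: "N k \<le> r k" for k
    unfolding r_def using member_le_sum[of k "{..k}" N] by auto
  have rk: "k \<le> r k" "r k \<le> r (Suc k)" for k
    by (auto simp: r_def)
  define f where "f k x = h (r (Suc k)) x - h (r k) x" for k x
  have fL2: "L2 M (f k)" for k
    unfolding f_def[abs_def] by (intro L2_diff h)
  have [measurable]: "f k \<in> borel_measurable M" for k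
    using fL2 by (simp add: L2_def)
  have fsq: "L2_sq M (f k) \<le> (1/4) ^ k" for k
    using le[OF rk(2)[of k]] N[OF rN[of k]]
    by (simp add: f_def L2_sq_def norm_minus_commute)
  have one: "L2 M (\<lambda>x. 1::real)"
    by (simp add: L2_def)
  have fint: "integrable M (\<lambda>x. norm (f k x))" for k
    using L2_norm_mult_integrable[OF fL2[of k] one] by simp
  have f1: "(\<integral>\<^sup>+x. norm (f k x) \<partial>M) \<le> ennreal ((1/2) ^ k * sqrt (measure M (space M)))" for k
  proof -
    have "(\<integral>x. norm (f k x) \<partial>M) \<le> sqrt (L2_sq M (f k)) * sqrt (L2_sq M (\<lambda>x. 1::real))"
      using L2_Cauchy_Schwarz_norm[OF fL2[of k] one] by simp
    also have "\<dots> \<le> (1/2) ^ k * sqrt (measure M (space M))"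
    proof (intro mult_mono)
      have "sqrt (L2_sq M (f k)) \<le> sqrt (((1/2) ^ k)\<^sup>2)"
        using fsq[of k] by (intro real_sqrt_le_mono) (simp add: power2_eq_square power_mult_distrib[symmetric])
      then show "sqrt (L2_sq M (f k)) \<le> (1/2) ^ k" by simp
    qed (auto simp: L2_sq_def)
    finally show ?thesis
      using fint[of k] by (subst nn_integral_eq_integral) (auto intro: ennreal_leI)
  qed
  have "(\<integral>\<^sup>+x. (\<Sum>k. ennreal (norm (f k x))) \<partial>M) = (\<Sum>k. \<integral>\<^sup>+x. norm (f k x) \<partial>M)"
    by (rule nn_integral_suminf) measurable
  also have "\<dots> \<le> (\<Sum>k. ennreal ((1/2) ^ k * sqrt (measure M (space M))))"
    by (intro suminf_le f1) auto
  also have "\<dots> < \<infinity>"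
  proof -
    have "summable (\<lambda>k. (1/2::real) ^ k * sqrt (measure M (space M)))"
      by (intro summable_mult2 summable_geometric) auto
    then show ?thesis
      by (subst suminf_ennreal2) auto
  qed
  finally have "AE x in M. (\<Sum>k. ennreal (norm (f k x))) \<noteq> \<infinity>"
    by (intro nn_integral_noteq_infinite) auto
  then have conv: "AE x in M. (\<lambda>k. h (r k) x) \<longlonglongrightarrow> lim (\<lambda>k. h (r k) x)"
  proof eventually_elim
    case (elim x)
    then have "summable (\<lambda>k. norm (f k x))"
      by (intro summable_suminf_not_top) (auto simp: top_ennreal_def)
    then have "summable (\<lambda>k. f k x)" by (rule summable_norm_cancel)
    then have "(\<lambda>k. \<Sum>i<k. f i x) \<longlonglongrightarrow> (\<Sum>k. f k x)"
      by (rule summable_LIMSEQ)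
    moreover have "(\<Sum>i<k. f i x) = h (r k) x - h (r 0) x" for k
      unfolding f_def by (rule sum_lessThan_telescope)
    ultimately have "(\<lambda>k. h (r k) x - h (r 0) x) \<longlonglongrightarrow> (\<Sum>k. f k x)" by simp
    then have "(\<lambda>k. (h (r k) x - h (r 0) x) + h (r 0) x) \<longlonglongrightarrow> (\<Sum>k. f k x) + h (r 0) x"
      by (intro tendsto_add tendsto_const)
    then have "convergent (\<lambda>k. h (r k) x)"
      by (auto simp: convergent_def)
    then show ?case by (simp add: convergent_LIMSEQ_iff)
  qed
  \<comment> \<open>Off the convergence set, whose complement is null, the value of
    \<open>lim\<close> is irrelevant; the definition keeps g measurable on the whole space.\<close>
  define g where "g x = lim (\<lambda>k. h (r k) x)" for x
  have [measurable]: "g \<in> borel_measurable M"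
    unfolding g_def[abs_def] by (rule borel_measurable_lim_metric) measurable
  have Fatou: "(\<integral>\<^sup>+x. ennreal ((norm (h n x - g x))\<^sup>2) \<partial>M) \<le> ennreal (e n)" for n
  proof -
    have "AE x in M. ennreal ((norm (h n x - g x))\<^sup>2) = liminf (\<lambda>k. ennreal ((norm (h n x - h (r k) x))\<^sup>2))"
      using conv
    proof eventually_elim
      case (elim x)
      then have "(\<lambda>k. ennreal ((norm (h n x - h (r k) x))\<^sup>2)) \<longlonglongrightarrow> ennreal ((norm (h n x - g x))\<^sup>2)"
        unfolding g_def by (intro tendsto_intros)
      then show ?case
        by (intro lim_imp_Liminf[symmetric]) auto
    qed
    then have "(\<integral>\<^sup>+x. ennreal ((norm (h n x - g x))\<^sup>2) \<partial>M)
        = (\<integral>\<^sup>+x. liminf (\<lambda>k. ennreal ((norm (h n x - h (r k) x))\<^sup>2)) \<partial>M)"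
      by (rule nn_integral_cong_AE)
    also have "\<dots> \<le> liminf (\<lambda>k. \<integral>\<^sup>+x. ennreal ((norm (h n x - h (r k) x))\<^sup>2) \<partial>M)"
      by (rule nn_integral_liminf) measurable
    also have "\<dots> \<le> ennreal (e n)"
    proof (rule Liminf_le)
      show "\<forall>\<^sub>F k in sequentially. (\<integral>\<^sup>+x. ennreal ((norm (h n x - h (r k) x))\<^sup>2) \<partial>M) \<le> ennreal (e n)"
      proof (rule eventually_sequentiallyI[of n])
        fix k assume "n \<le> k"
        then have "n \<le> r k" using rk(1)[of k] by simp
        from le[OF this] show "(\<integral>\<^sup>+x. ennreal ((norm (h n x - h (r k) x))\<^sup>2) \<partial>M) \<le> ennreal (e n)"
          using L2_integrable_sq[OF L2_diff[OF h[of n] h[of "r k"]]]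
          by (subst nn_integral_eq_integral) (auto simp: L2_sq_def intro: ennreal_leI)
      qed
    qed simp
    finally show ?thesis .
  qed
  have e0: "0 \<le> e n" for n
    using le[of n n] L2_sq_nonneg[of M "\<lambda>x. h n x - h n x"] by linarith
  have L2d: "L2 M (\<lambda>x. h n x - g x)" for n
    unfolding L2_def
  proof
    show "integrable M (\<lambda>x. (norm (h n x - g x))\<^sup>2)"
      using Fatou[of n] by (intro integrableI_bounded) (auto intro: le_less_trans)
  qed measurable
  have "L2 M (\<lambda>x. h 0 x - (h 0 x - g x))"
    by (intro L2_diff h L2d)
  then have "L2 M g" by simp
  moreover have "L2_sq M (\<lambda>x. h n x - g x) \<le> e n" for n
  proof -
    have "ennreal (L2_sq M (\<lambda>x. h n x - g x)) \<le> ennreal (e n)"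
      using Fatou[of n] L2_integrable_sq[OF L2d[of n]]
      by (subst (asm) nn_integral_eq_integral) (auto simp: L2_sq_def)
    then show ?thesis using e0[of n] by simp
  qed
  ultimately show ?thesis by (rule that)
qed

text \<open>Elements of almost minimal norm in the nested convex sets of functions satisfying the
  constraints up to an error of $1/(n+1)$ form a Cauchy sequence by the parallelogram law.\<close>

theorem (in finite_measure) L2_weak_limit_exists:
  fixes f :: "nat \<Rightarrow> 'a \<Rightarrow> 'b::euclidean_space" and J :: "(('a \<Rightarrow> 'b) \<times> real) set"
  assumes f: "\<And>k. L2 M (f k)"
    and bound: "\<And>\<epsilon>. 0 < \<epsilon> \<Longrightarrow> \<forall>\<^sub>F k in sequentially. L2_sq M (f k) \<le> C + \<epsilon>"
    and J: "\<And>\<psi> l. (\<psi>, l) \<in> J \<Longrightarrow> L2 M \<psi>"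
    and conv: "\<And>\<epsilon>. 0 < \<epsilon> \<Longrightarrow> \<forall>\<^sub>F k in sequentially. \<forall>(\<psi>, l)\<in>J. \<bar>(\<integral>x. f k x \<bullet> \<psi> x \<partial>M) - l\<bar> \<le> \<epsilon>"
  obtains g where "L2 M g" "L2_sq M g \<le> C" "\<And>\<psi> l. (\<psi>, l) \<in> J \<Longrightarrow> (\<integral>x. g x \<bullet> \<psi> x \<partial>M) = l"
proof -
  define \<epsilon> where "\<epsilon> n = 1 / (real n + 1)" for n
  have \<epsilon>0: "0 < \<epsilon> n" for n by (simp add: \<epsilon>_def)
  have \<epsilon>_mono: "m \<le> n \<Longrightarrow> \<epsilon> n \<le> \<epsilon> m" for m n by (auto simp: \<epsilon>_def field_simps)
  have \<epsilon>_lim: "\<epsilon> \<longlonglongrightarrow> 0"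
    unfolding \<epsilon>_def using LIMSEQ_inverse_real_of_nat by (simp add: inverse_eq_divide add.commute)
  \<comment> \<open>Convex and decreasing in n. The tolerance is uniform over J, so that a single
    member of the sequence meets all relaxed constraints at once.\<close>
  define K where "K n = {h. L2 M h \<and> (\<forall>(\<psi>, l)\<in>J. \<bar>(\<integral>x. h x \<bullet> \<psi> x \<partial>M) - l\<bar> \<le> \<epsilon> n)}" for n
  have K_ex: "\<exists>h\<in>K n. L2_sq M h \<le> C + \<delta>" if "0 < \<delta>" for n \<delta>
  proof -
    have "\<forall>\<^sub>F k in sequentially. f k \<in> K n \<and> L2_sq M (f k) \<le> C + \<delta>"
      using conv[OF \<epsilon>0[of n]] bound[OF that] by eventually_elim (auto simp: K_def f)
    then show ?thesis
      using eventually_happens'[OF sequentially_bot] by blast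
  qed
  have K_mid: "(\<lambda>x. (1/2) *\<^sub>R (h x + h' x)) \<in> K n" if "h \<in> K n" "h' \<in> K n" for h h' n
  proof -
    have hL: "L2 M h" "L2 M h'" using that by (auto simp: K_def)
    have "\<bar>(\<integral>x. ((1/2) *\<^sub>R (h x + h' x)) \<bullet> \<psi> x \<partial>M) - l\<bar> \<le> \<epsilon> n" if "(\<psi>, l) \<in> J" for \<psi> l
    proof -
      have "(\<integral>x. ((1/2) *\<^sub>R (h x + h' x)) \<bullet> \<psi> x \<partial>M) = (\<integral>x. h x \<bullet> \<psi> x \<partial>M) / 2 + (\<integral>x. h' x \<bullet> \<psi> x \<partial>M) / 2"
        using L2_inner_integrable[OF hL(1) J[OF that]] L2_inner_integrable[OF hL(2) J[OF that]]
        by (simp add: inner_add_left field_simps)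
      moreover have "\<bar>(\<integral>x. h x \<bullet> \<psi> x \<partial>M) - l\<bar> \<le> \<epsilon> n" "\<bar>(\<integral>x. h' x \<bullet> \<psi> x \<partial>M) - l\<bar> \<le> \<epsilon> n"
        using \<open>h \<in> K n\<close> \<open>h' \<in> K n\<close> that by (auto simp: K_def)
      ultimately show ?thesis by (simp add: abs_le_iff field_simps)
    qed
    then show ?thesis
      using hL by (auto simp: K_def intro!: L2_scaleR[of M _ "1/2", simplified] L2_add)
  qed
  have K_mono: "K n \<subseteq> K m" if "m \<le> n" for m n
    using \<epsilon>_mono[OF that] by (fastforce simp: K_def)
  define d where "d n = Inf (L2_sq M ` K n)" for n
  have bdd: "bdd_below (L2_sq M ` K n)" for n
    by (intro bdd_belowI[of _ 0]) (auto simp: L2_sq_nonneg)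
  have d_le: "d n \<le> L2_sq M h" if "h \<in> K n" for n h
    unfolding d_def using that by (intro cInf_lower bdd) auto
  have ne: "L2_sq M ` K n \<noteq> {}" for n
    using K_ex[of 1 n] by auto
  have d_mono: "incseq d"
  proof (rule incseq_SucI)
    show "d n \<le> d (Suc n)" for n
      unfolding d_def by (intro cInf_superset_mono ne bdd image_mono K_mono) simp
  qed
  have dC: "d n \<le> C" for n
  proof (rule field_le_epsilon)
    fix \<delta> :: real assume "0 < \<delta>"
    then obtain h where "h \<in> K n" "L2_sq M h \<le> C + \<delta>" using K_ex by blast
    then show "d n \<le> C + \<delta>" using d_le[of h n] by linarith
  qed
  have "\<exists>D. d \<longlonglongrightarrow> D \<and> (\<forall>n. d n \<le> D)"
    using incseq_convergent[OF d_mono, of C] dC by blast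
  then obtain D where D: "d \<longlonglongrightarrow> D" "\<And>n. d n \<le> D" by blast
  have DC: "D \<le> C" using D(1) dC by (intro LIMSEQ_le_const2) auto
  have "\<exists>h\<in>K n. L2_sq M h < d n + \<epsilon> n" for n
    using cInf_lessD[OF ne[of n], of "d n + \<epsilon> n"] \<epsilon>0[of n] by (auto simp: d_def)
  then obtain h where h: "\<And>n. h n \<in> K n" "\<And>n. L2_sq M (h n) < d n + \<epsilon> n" by metis
  have hL2: "L2 M (h n)" for n using h(1)[of n] by (simp add: K_def)
  \<comment> \<open>The parallelogram law bounds the squared distance of \<open>h n\<close> and
    \<open>h m\<close> by 2(d n + \<epsilon> n) + 2(d m + \<epsilon> m) - 4 d n, where
    \<open>d m \<le> D\<close> and \<open>\<epsilon> m \<le> \<epsilon> n\<close>.\<close>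
  define e where "e n = 2 * (D - d n) + 4 * \<epsilon> n" for n
  have cauchy: "L2_sq M (\<lambda>x. h n x - h m x) \<le> e n" if "n \<le> m" for n m
  proof -
    have "h m \<in> K n" using h(1)[of m] K_mono[OF that] by blast
    define mid where "mid = L2_sq M (\<lambda>x. (1/2) *\<^sub>R (h n x + h m x))"
    have "d n \<le> mid"
      unfolding mid_def by (intro d_le K_mid h \<open>h m \<in> K n\<close>)
    then have "2 * L2_sq M (h n) + 2 * L2_sq M (h m) - 4 * mid \<le> 2 * (D - d n) + 4 * \<epsilon> n"
      using h(2)[of n] h(2)[of m] D(2)[of m] \<epsilon>_mono[OF that] by argo
    then show ?thesis
      using L2_sq_parallelogram[OF hL2[of n] hL2[of m]] by (simp add: e_def mid_def)
  qed
  have e_lim: "e \<longlonglongrightarrow> 0"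
  proof -
    have "e \<longlonglongrightarrow> 2 * (D - D) + 4 * 0"
      unfolding e_def by (intro tendsto_intros D \<epsilon>_lim)
    then show ?thesis by simp
  qed
  obtain g where g: "L2 M g" "\<And>n. L2_sq M (\<lambda>x. h n x - g x) \<le> e n"
    by (rule L2_complete[OF hL2 _ e_lim], rule cauchy, assumption) (rule that)
  have sqrt_lim: "(\<lambda>n. sqrt (e n)) \<longlonglongrightarrow> 0"
    using tendsto_real_sqrt[OF e_lim] by simp
  have "L2_sq M g \<le> D"
  proof -
    have "sqrt (L2_sq M g) \<le> sqrt (d n + \<epsilon> n) + sqrt (e n)" for n
    proof -
      have "sqrt (L2_sq M (\<lambda>x. h n x + (g x - h n x))) \<le> sqrt (L2_sq M (h n)) + sqrt (L2_sq M (\<lambda>x. g x - h n x))"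
        by (intro L2_sq_add_le L2_diff hL2 g)
      moreover have "L2_sq M (\<lambda>x. g x - h n x) = L2_sq M (\<lambda>x. h n x - g x)"
        by (simp add: L2_sq_def norm_minus_commute)
      ultimately have "sqrt (L2_sq M g) \<le> sqrt (L2_sq M (h n)) + sqrt (L2_sq M (\<lambda>x. h n x - g x))"
        by simp
      also have "\<dots> \<le> sqrt (d n + \<epsilon> n) + sqrt (e n)"
        by (intro add_mono real_sqrt_le_mono g less_imp_le h)
      finally show ?thesis .
    qed
    moreover have "(\<lambda>n. sqrt (d n + \<epsilon> n) + sqrt (e n)) \<longlonglongrightarrow> sqrt (D + 0) + 0"
      by (intro tendsto_intros D \<epsilon>_lim sqrt_lim)
    ultimately have "sqrt (L2_sq M g) \<le> sqrt (D + 0) + 0"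
      by (intro LIMSEQ_le_const) auto
    then show ?thesis by simp
  qed
  moreover have "(\<integral>x. g x \<bullet> \<psi> x \<partial>M) = l" if "(\<psi>, l) \<in> J" for \<psi> l
  proof -
    have "\<bar>(\<integral>x. g x \<bullet> \<psi> x \<partial>M) - l\<bar> \<le> sqrt (e n) * sqrt (L2_sq M \<psi>) + \<epsilon> n" for n
    proof -
      have "\<bar>\<integral>x. (h n x - g x) \<bullet> \<psi> x \<partial>M\<bar> \<le> sqrt (L2_sq M (\<lambda>x. h n x - g x)) * sqrt (L2_sq M \<psi>)"
        by (intro L2_Cauchy_Schwarz L2_diff hL2 g J[OF that])
      also have "\<dots> \<le> sqrt (e n) * sqrt (L2_sq M \<psi>)"
        by (intro mult_right_mono real_sqrt_le_mono g) (simp add: L2_sq_nonneg)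
      finally have "\<bar>\<integral>x. (h n x - g x) \<bullet> \<psi> x \<partial>M\<bar> \<le> sqrt (e n) * sqrt (L2_sq M \<psi>)" .
      moreover have "(\<integral>x. (h n x - g x) \<bullet> \<psi> x \<partial>M) = (\<integral>x. h n x \<bullet> \<psi> x \<partial>M) - (\<integral>x. g x \<bullet> \<psi> x \<partial>M)"
        using L2_inner_integrable[OF hL2[of n] J[OF that]] L2_inner_integrable[OF g(1) J[OF that]]
        by (simp add: inner_diff_left)
      moreover have "\<bar>(\<integral>x. h n x \<bullet> \<psi> x \<partial>M) - l\<bar> \<le> \<epsilon> n"
        using h(1)[of n] that by (auto simp: K_def)
      ultimately show ?thesis by linarith
    qed
    moreover have "(\<lambda>n. sqrt (e n) * sqrt (L2_sq M \<psi>) + \<epsilon> n) \<longlonglongrightarrow> 0 * sqrt (L2_sq M \<psi>) + 0"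
      by (intro tendsto_intros sqrt_lim \<epsilon>_lim)
    ultimately have "\<bar>(\<integral>x. g x \<bullet> \<psi> x \<partial>M) - l\<bar> \<le> 0 * sqrt (L2_sq M \<psi>) + 0"
      by (intro LIMSEQ_le_const) auto
    then show ?thesis by simp
  qed
  ultimately show ?thesis
    using g(1) DC by (intro that) auto
qed

section \<open>Curves of class $W^{2,2}$\<close>

text \<open>The Lebesgue differentiation result used here controls averages over [x,x+h] only;
  applied to the reflected density g(-t) as well, it yields the left averages. Hence the exceptional
  set is a null set together with a reflected one.\<close>

lemma has_vector_derivative_indefinite_integral_AE_UNIV:
  fixes F g :: "real \<Rightarrow> 'a::euclidean_space"
  assumes int: "\<And>a b. a \<le> b \<Longrightarrow> (g has_integral F b - F a) {a..b}"
  obtains N where "negligible N" "\<And>x. x \<notin> N \<Longrightarrow> (F has_vector_derivative g x) (at x)"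
proof -
  have g1: "g integrable_on cbox a b" for a b :: real
    using int[of a b] by (cases "a \<le> b") (auto simp: integrable_on_def)
  have refl: "((\<lambda>x. g (- x)) has_integral F b - F a) {-b..-a}" if "a \<le> b" for a b
    using int[OF that] has_integral_reflect_real[of g "F b - F a" b a] by simp
  have g2: "(\<lambda>x. g (- x)) integrable_on cbox a b" for a b :: real
    using refl[of "-b" "-a"] by (cases "a \<le> b") (auto simp: integrable_on_def)
  obtain N1 where N1: "negligible N1"
    "\<And>x e. x \<notin> N1 \<Longrightarrow> 0 < e \<Longrightarrow> \<exists>d>0. \<forall>h. 0 < h \<and> h < d \<longrightarrow>
       norm (integral (cbox x (x + h *\<^sub>R One)) g /\<^sub>R h ^ DIM(real) - g x) < e"
    using integrable_ccontinuous_explicit[OF g1] by blast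
  obtain N2 where N2: "negligible N2"
    "\<And>x e. x \<notin> N2 \<Longrightarrow> 0 < e \<Longrightarrow> \<exists>d>0. \<forall>h. 0 < h \<and> h < d \<longrightarrow>
       norm (integral (cbox x (x + h *\<^sub>R One)) (\<lambda>x. g (- x)) /\<^sub>R h ^ DIM(real) - g (- x)) < e"
    using integrable_ccontinuous_explicit[OF g2] by blast
  define N where "N = N1 \<union> uminus ` N2"
  have "negligible N"
    unfolding N_def
  proof (intro negligible_Un N1(1))
    show "negligible (uminus ` N2)"
    proof (rule negligible_locally_Lipschitz_image[OF _ N2(1)])
      fix x
      have "\<forall>y\<in>N2 \<inter> UNIV. norm (- y - - x) \<le> 1 * norm (y - x)" by auto
      then show "\<exists>T B. open T \<and> x \<in> T \<and> (\<forall>y\<in>N2 \<inter> T. norm (- y - - x) \<le> B * norm (y - x))"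
        using open_UNIV UNIV_I by blast
    qed simp
  qed
  moreover have "(F has_vector_derivative g x) (at x)" if "x \<notin> N" for x
    unfolding has_vector_derivative_def has_derivative_within_alt
  proof (intro conjI allI impI)
    show "bounded_linear (\<lambda>h. h *\<^sub>R g x)" by (rule bounded_linear_scaleR_left)
    fix e :: real assume e: "0 < e"
    have xN: "x \<notin> N1" "- x \<notin> N2"
      using that image_eqI[of x uminus "-x" N2] by (auto simp: N_def)
    obtain d1 where d1: "0 < d1" "\<And>h. 0 < h \<Longrightarrow> h < d1 \<Longrightarrow>
       norm (integral (cbox x (x + h *\<^sub>R One)) g /\<^sub>R h ^ DIM(real) - g x) < e"
      using N1(2)[OF xN(1) e] by blast
    obtain d2 where d2: "0 < d2" "\<And>h. 0 < h \<Longrightarrow> h < d2 \<Longrightarrow>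
       norm (integral (cbox (- x) (- x + h *\<^sub>R One)) (\<lambda>x. g (- x)) /\<^sub>R h ^ DIM(real) - g x) < e"
      using N2(2)[OF xN(2) e] by auto
    have scale: "norm (v - h *\<^sub>R g x) \<le> e * h" if "norm (v /\<^sub>R h - g x) < e" "0 < h" for v h
    proof -
      have "v - h *\<^sub>R g x = h *\<^sub>R (v /\<^sub>R h - g x)" using that(2) by (simp add: scaleR_diff_right)
      then have "norm (v - h *\<^sub>R g x) = h * norm (v /\<^sub>R h - g x)" using that(2) by simp
      then show ?thesis using that by (simp add: mult.commute)
    qed
    show "\<exists>d>0. \<forall>y\<in>UNIV. norm (y - x) < d \<longrightarrow> norm (F y - F x - (y - x) *\<^sub>R g x) \<le> e * norm (y - x)"
    proof (intro exI[of _ "min d1 d2"] conjI ballI impI)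
      fix y assume y: "norm (y - x) < min d1 d2"
      consider "y = x" | "x < y" | "y < x" by linarith
      then show "norm (F y - F x - (y - x) *\<^sub>R g x) \<le> e * norm (y - x)"
      proof cases
        case 2
        have "integral {x..y} g = F y - F x" using int[of x y] 2 by (simp add: integral_unique)
        then show ?thesis using d1(2)[of "y - x"] scale[where v="F y - F x" and h="y - x"] 2 y by simp
      next
        case 3
        have "integral {-x..-y} (\<lambda>x. g (- x)) = F x - F y" using refl[of y x] 3 by (simp add: integral_unique)
        then have "norm ((F x - F y) - (x - y) *\<^sub>R g x) \<le> e * (x - y)"
          using d2(2)[of "x - y"] scale[where v="F x - F y" and h="x - y"] 3 y by simp
        moreover have "F y - F x - (y - x) *\<^sub>R g x = - ((F x - F y) - (x - y) *\<^sub>R g x)"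
          by (simp add: algebra_simps)
        ultimately show ?thesis using 3 by (simp only: norm_minus_cancel) simp
      qed simp
    qed (use d1 d2 in auto)
  qed
  ultimately show ?thesis by (rule that)
qed

text \<open>Outside [a,b] the density is set to 0 and F is frozen at its endpoint value, which
  reduces the claim to the whole line.\<close>

lemma has_vector_derivative_indefinite_integral_AE:
  fixes F g :: "real \<Rightarrow> 'a::euclidean_space"
  assumes int: "\<And>x y. a \<le> x \<Longrightarrow> x \<le> y \<Longrightarrow> y \<le> b \<Longrightarrow> (g has_integral F y - F x) {x..y}"
    and "a < b"
  obtains N where "negligible N" "\<And>x. x \<in> {a<..<b} - N \<Longrightarrow> (F has_vector_derivative g x) (at x)"
proof -
  define G where "G x = (if x \<in> {a..b} then g x else 0)" for x
  define H where "H x = F (max a (min b x))" for x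
  have "(G has_integral H y - H x) {x..y}" if "x \<le> y" for x y
  proof (cases "y < a \<or> b < x")
    case True
    then have "{a..b} \<inter> {x..y} = {}" "H y = H x" using \<open>a < b\<close> \<open>x \<le> y\<close> by (auto simp: H_def max_def min_def)
    then show ?thesis
      unfolding G_def has_integral_restrict_Int by simp
  next
    case False
    then have "{a..b} \<inter> {x..y} = {max a x..min b y}" "H x = F (max a x)" "H y = F (min b y)"
      using \<open>a < b\<close> \<open>x \<le> y\<close> by (auto simp: H_def max_def min_def)
    moreover have "(g has_integral F (min b y) - F (max a x)) {max a x..min b y}"
      using False \<open>a < b\<close> \<open>x \<le> y\<close> by (intro int) auto
    ultimately show ?thesis
      unfolding G_def has_integral_restrict_Int by simp
  qed
  then obtain N where N: "negligible N" "\<And>x. x \<notin> N \<Longrightarrow> (H has_vector_derivative G x) (at x)"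
    using has_vector_derivative_indefinite_integral_AE_UNIV by blast
  have "(F has_vector_derivative g x) (at x)" if x: "x \<in> {a<..<b} - N" for x
  proof -
    have "(H has_vector_derivative g x) (at x)"
      using N(2)[of x] x by (simp add: G_def)
    then show ?thesis
      by (rule has_vector_derivative_transform_within_open[of _ _ _ "{a<..<b}"]) (use x in \<open>auto simp: H_def\<close>)
  qed
  with N(1) show ?thesis by (rule that)
qed

section \<open>Pointwise derivatives, periodicity and continuity of W22 curves\<close>

lemma W22_periodic: "W22 \<gamma> \<Longrightarrow> \<gamma> (t + 1) = \<gamma> t"
  by (simp add: W22_def)

text \<open>Valid also where no derivative exists, because both sides choose from the same, possibly
  empty, set of candidates. This makes \<open>d2\<close> periodic at every point although it is a
  genuine derivative only almost everywhere.\<close>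

lemma vector_derivative_shift:
  "vector_derivative (\<lambda>x. f (x + c)) (at t) = vector_derivative f (at (t + c))"
proof -
  have "((\<lambda>x. f (x + c)) has_vector_derivative D) (at t) \<longleftrightarrow> (f has_vector_derivative D) (at (t + c))" for D
  proof
    assume "((\<lambda>x. f (x + c)) has_vector_derivative D) (at t)"
    then have "((\<lambda>x. f (x + c)) has_vector_derivative D) (at (t + c - c))" by simp
    moreover have "((\<lambda>x. x - c) has_vector_derivative 1) (at (t + c))"
      unfolding has_real_derivative_iff_has_vector_derivative[symmetric]
      by (auto intro!: derivative_eq_intros)
    ultimately show "(f has_vector_derivative D) (at (t + c))"
      using vector_diff_chain_at[of "\<lambda>x. x - c" 1 "t + c" "\<lambda>x. f (x + c)" D] by (simp add: o_def)
  next
    assume "(f has_vector_derivative D) (at (t + c))"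
    moreover have "((\<lambda>x. x + c) has_vector_derivative 1) (at t)"
      unfolding has_real_derivative_iff_has_vector_derivative[symmetric]
      by (auto intro!: derivative_eq_intros)
    ultimately show "((\<lambda>x. f (x + c)) has_vector_derivative D) (at t)"
      using vector_diff_chain_at[of "\<lambda>x. x + c" 1 t f D] by (simp add: o_def)
  qed
  then show ?thesis unfolding vector_derivative_def by simp
qed

lemma W22_d1: "W22 \<gamma> \<Longrightarrow> (\<gamma> has_vector_derivative d1 \<gamma> t) (at t)"
  unfolding W22_def d1_def by (simp add: vector_derivative_works)

lemma d1_periodic: "(\<And>t. \<gamma> (t + 1) = \<gamma> t) \<Longrightarrow> d1 \<gamma> (t + 1) = d1 \<gamma> t"
  using vector_derivative_shift[of \<gamma> 1 t] by (simp add: d1_def)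

lemma d2_periodic: "(\<And>t. \<gamma> (t + 1) = \<gamma> t) \<Longrightarrow> d2 \<gamma> (t + 1) = d2 \<gamma> t"
  using vector_derivative_shift[of "d1 \<gamma>" 1 t] d1_periodic[of \<gamma>] by (simp add: d2_def)

text \<open>Connects the pointwise \<open>d2\<close> with whichever density happens to represent
  \<open>d1\<close>. The endpoints join the null set because differentiation is available in the
  interior only.\<close>

lemma d2_AE_eq_density:
  assumes "\<And>x y. a \<le> x \<Longrightarrow> x \<le> y \<Longrightarrow> y \<le> b \<Longrightarrow> (g has_integral d1 \<gamma> y - d1 \<gamma> x) {x..y}" and "a < b"
  obtains N where "negligible N" "\<And>x. x \<in> {a..b} - N \<Longrightarrow> d2 \<gamma> x = g x"
    "\<And>x. x \<in> {a..b} - N \<Longrightarrow> (d1 \<gamma> has_vector_derivative d2 \<gamma> x) (at x)"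
proof -
  obtain N where N: "negligible N" "\<And>x. x \<in> {a<..<b} - N \<Longrightarrow> (d1 \<gamma> has_vector_derivative g x) (at x)"
    using has_vector_derivative_indefinite_integral_AE[OF assms] by blast
  have eq: "d2 \<gamma> x = g x" if "x \<in> {a<..<b} - N" for x
    using N(2)[OF that] by (simp add: d2_def vector_derivative_at)
  have "negligible (N \<union> {a, b})"
    using N(1) by (intro negligible_Un) (auto intro: negligible_finite)
  moreover have "x \<in> {a<..<b} - N" if "x \<in> {a..b} - (N \<union> {a, b})" for x
    using that by auto
  ultimately show ?thesis
    using N(2) eq by (intro that[of "N \<union> {a, b}"]) simp_all
qed

text \<open>From here on the anonymous density in \<open>W22\<close> can be taken to be
  \<open>d2\<close> itself.\<close>

lemma W22_d2_integral:
  assumes "W22 \<gamma>"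
  shows "a \<le> b \<Longrightarrow> (d2 \<gamma> has_integral d1 \<gamma> b - d1 \<gamma> a) {a..b}"
    and "(\<lambda>t. (norm (d2 \<gamma> t))\<^sup>2) integrable_on {0..1}"
proof -
  obtain g where g: "\<And>a b. a \<le> b \<Longrightarrow> (g has_integral d1 \<gamma> b - d1 \<gamma> a) {a..b}"
    "(\<lambda>t. (norm (g t))\<^sup>2) integrable_on {0..1}"
    using assms unfolding W22_def by blast
  have g01: "\<And>x y. 0 \<le> x \<Longrightarrow> x \<le> y \<Longrightarrow> y \<le> 1 \<Longrightarrow> (g has_integral d1 \<gamma> y - d1 \<gamma> x) {x..y}"
    using g(1) by auto
  obtain N where N: "negligible N" "\<And>x. x \<in> {0..1} - N \<Longrightarrow> d2 \<gamma> x = g x"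
    by (rule d2_AE_eq_density[OF _ zero_less_one], erule (2) g01) (rule that)
  show "(\<lambda>t. (norm (d2 \<gamma> t))\<^sup>2) integrable_on {0..1}"
    by (rule integrable_spike[OF g(2) N(1)]) (simp add: N(2))
  show "(d2 \<gamma> has_integral d1 \<gamma> b - d1 \<gamma> a) {a..b}" if "a \<le> b"
  proof (cases "a = b")
    case False
    then have "a < b" using that by simp
    have gab: "\<And>x y. a \<le> x \<Longrightarrow> x \<le> y \<Longrightarrow> y \<le> b \<Longrightarrow> (g has_integral d1 \<gamma> y - d1 \<gamma> x) {x..y}"
      using g(1) by auto
    obtain N where N: "negligible N" "\<And>x. x \<in> {a..b} - N \<Longrightarrow> d2 \<gamma> x = g x"
      by (rule d2_AE_eq_density[OF _ \<open>a < b\<close>], erule (2) gab) (rule that)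
    show ?thesis
      by (rule has_integral_spike[OF N(1) _ g(1)[OF that]]) (simp add: N(2))
  qed (simp add: has_integral_refl)
qed

lemma W22_continuous_d1:
  assumes "W22 \<gamma>"
  shows "continuous_on S (d1 \<gamma>)"
proof -
  have "isCont (d1 \<gamma>) t" for t
  proof -
    have "continuous_on {t-1..t+1} (\<lambda>x. integral {t-1..x} (d2 \<gamma>))"
      using W22_d2_integral(1)[OF assms, of "t-1" "t+1"]
      by (intro indefinite_integral_continuous_1) (auto simp: integrable_on_def)
    then have "continuous_on {t-1..t+1} (\<lambda>x. d1 \<gamma> (t-1) + integral {t-1..x} (d2 \<gamma>))"
      by (intro continuous_intros)
    then have "continuous_on {t-1..t+1} (d1 \<gamma>)"
    proof (rule continuous_on_eq)
      fix x assume "x \<in> {t-1..t+1}"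
      then have "integral {t-1..x} (d2 \<gamma>) = d1 \<gamma> x - d1 \<gamma> (t-1)"
        by (intro integral_unique W22_d2_integral(1)[OF assms]) simp
      then show "d1 \<gamma> (t-1) + integral {t-1..x} (d2 \<gamma>) = d1 \<gamma> x" by simp
    qed
    then show ?thesis
      by (rule continuous_on_interior) simp
  qed
  then show ?thesis by (simp add: continuous_at_imp_continuous_on)
qed

lemma W22_continuous: "W22 \<gamma> \<Longrightarrow> continuous_on S \<gamma>"
  by (meson W22_d1 continuous_at_imp_continuous_on has_vector_derivative_continuous)

lemma periodic_shift_int:
  fixes f :: "real \<Rightarrow> 'a"
  assumes "\<And>t. f (t + 1) = f t"
  shows "f (t + of_int n) = f t"
proof (induction n arbitrary: t rule: int_induct[of _ 0])
  case (step1 i)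
  then show ?case using assms[of "t + of_int i"] by (simp add: add.assoc[symmetric])
next
  case (step2 i)
  then show ?case using assms[of "t + of_int i - 1"] by (simp add: algebra_simps)
qed simp

text \<open>A limit curve comes with a density on one period only. Periodicity of \<open>d1\<close>
  and \<open>d2\<close> carries the integral formula to every [n,n+1], and additivity over adjacent
  intervals extends it to all compact intervals.\<close>

lemma W22_intro:
  assumes per: "\<And>t. \<gamma> (t + 1) = \<gamma> t" and diff: "\<And>t. \<gamma> differentiable (at t)"
    and int: "\<And>x y. 0 \<le> x \<Longrightarrow> x \<le> y \<Longrightarrow> y \<le> 1 \<Longrightarrow> (g has_integral d1 \<gamma> y - d1 \<gamma> x) {x..y}"
    and sq: "(\<lambda>t. (norm (g t))\<^sup>2) integrable_on {0..1}"
  shows "W22 \<gamma>"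
proof -
  obtain N where N: "negligible N" "\<And>x. x \<in> {0..1} - N \<Longrightarrow> d2 \<gamma> x = g x"
    by (rule d2_AE_eq_density[OF _ zero_less_one], erule (2) int) (rule that)
  define Q where "Q a b \<longleftrightarrow> (\<forall>x y. a \<le> x \<and> x \<le> y \<and> y \<le> b \<longrightarrow> (d2 \<gamma> has_integral d1 \<gamma> y - d1 \<gamma> x) {x..y})" for a b
  have Q0: "Q 0 1"
    unfolding Q_def
  proof (intro allI impI, elim conjE)
    fix x y :: real assume xy: "0 \<le> x" "x \<le> y" "y \<le> 1"
    show "(d2 \<gamma> has_integral d1 \<gamma> y - d1 \<gamma> x) {x..y}"
      by (rule has_integral_spike[OF N(1) _ int[OF xy]]) (use xy N(2) in auto)
  qed
  have Qn: "Q (of_int n) (of_int n + 1)" for n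
    unfolding Q_def
  proof (intro allI impI, elim conjE)
    fix x y :: real assume xy: "of_int n \<le> x" "x \<le> y" "y \<le> of_int n + 1"
    have p1: "d1 \<gamma> (t + of_int m) = d1 \<gamma> t" and p2: "d2 \<gamma> (t + of_int m) = d2 \<gamma> t" for t m
      using periodic_shift_int[of "d1 \<gamma>" t m] periodic_shift_int[of "d2 \<gamma>" t m] d1_periodic[of \<gamma>, OF per] d2_periodic[of \<gamma>, OF per]
      by simp_all
    have "(d2 \<gamma> has_integral d1 \<gamma> (y - of_int n) - d1 \<gamma> (x - of_int n)) {x - of_int n..y - of_int n}"
      using Q0 xy by (simp add: Q_def)
    then have "((\<lambda>t. d2 \<gamma> (t + of_int n)) has_integral d1 \<gamma> y - d1 \<gamma> x) {x - of_int n..y - of_int n}"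
      using p1[of "y - of_int n" n] p1[of "x - of_int n" n] by (simp add: p2)
    then show "(d2 \<gamma> has_integral d1 \<gamma> y - d1 \<gamma> x) {x..y}"
      using has_integral_shift_Icc_real[of "d2 \<gamma>" "of_int n" _ "x - of_int n" "y - of_int n"]
      by (simp add: o_def add.commute)
  qed
  have Q_join: "Q a c" if "Q a b" "Q b c" for a b c
    unfolding Q_def
  proof (intro allI impI, elim conjE)
    fix x y assume xy: "a \<le> x" "x \<le> y" "y \<le> c"
    consider "y \<le> b" | "b \<le> x" | "x \<le> b" "b \<le> y" by linarith
    then show "(d2 \<gamma> has_integral d1 \<gamma> y - d1 \<gamma> x) {x..y}"
    proof cases
      case 3
      have "(d2 \<gamma> has_integral d1 \<gamma> b - d1 \<gamma> x) {x..b}" "(d2 \<gamma> has_integral d1 \<gamma> y - d1 \<gamma> b) {b..y}"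
        using that 3 xy by (auto simp: Q_def)
      from has_integral_combine[OF 3 this] show ?thesis by simp
    qed (use that xy in \<open>auto simp: Q_def\<close>)
  qed
  have QN: "Q (- real n) (real n)" for n
  proof (induction n)
    case 0
    have "x = 0 \<and> y = 0" if "0 \<le> x" "x \<le> y" "y \<le> 0" for x y :: real
      using that by linarith
    then show ?case by (fastforce simp: Q_def has_integral_refl)
  next
    case (Suc n)
    have "Q (- real (Suc n)) (- real n)" "Q (real n) (real (Suc n))"
      using Qn[of "- int (Suc n)"] Qn[of "int n"] by (simp_all add: algebra_simps)
    with Suc show ?case using Q_join by blast
  qed
  have "(d2 \<gamma> has_integral d1 \<gamma> b - d1 \<gamma> a) {a..b}" if "a \<le> b" for a b
  proof -
    obtain n where n: "max \<bar>a\<bar> \<bar>b\<bar> \<le> real n" using real_arch_simple by blast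
    then have "- real n \<le> a" "b \<le> real n" by auto
    then show ?thesis using QN[of n] that by (auto simp: Q_def)
  qed
  moreover have "(\<lambda>t. (norm (d2 \<gamma> t))\<^sup>2) integrable_on {0..1}"
    by (rule integrable_spike[OF sq N(1)]) (simp add: N(2))
  ultimately show ?thesis
    using per diff unfolding W22_def by (intro conjI exI[of _ "d2 \<gamma>"]) auto
qed

section \<open>Square integrability on an interval, in the Lebesgue and the Henstock-Kurzweil
  sense\<close>

lemma L2_lebesgue_onI:
  fixes f :: "real \<Rightarrow> 'a::euclidean_space"
  assumes "f \<in> borel_measurable (lebesgue_on {a..b})" "(\<lambda>t. (norm (f t))\<^sup>2) integrable_on {a..b}"
  shows "L2 (lebesgue_on {a..b}) f"
  unfolding L2_def using assms
  by (auto intro!: absolutely_integrable_imp_integrable nonnegative_absolutely_integrable_1)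

lemma L2_lebesgue_on_sq:
  fixes f :: "real \<Rightarrow> 'a::euclidean_space"
  assumes "L2 (lebesgue_on {a..b}) f"
  shows "(\<lambda>t. (norm (f t))\<^sup>2) integrable_on {a..b}"
    and "L2_sq (lebesgue_on {a..b}) f = integral {a..b} (\<lambda>t. (norm (f t))\<^sup>2)"
  using L2_integrable_sq[OF assms] unfolding L2_sq_def
  by (auto intro: integrable_on_lebesgue_on lebesgue_integral_eq_integral)

lemma L2_absolutely_integrable:
  fixes f :: "real \<Rightarrow> 'a::euclidean_space"
  assumes "L2 (lebesgue_on {a..b}) f"
  shows "f absolutely_integrable_on {a..b}"
proof (rule measurable_bounded_by_integrable_imp_absolutely_integrable)
  show "(\<lambda>t. 1 + (norm (f t))\<^sup>2) integrable_on {a..b}"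
    using L2_lebesgue_on_sq(1)[OF assms] by (intro integrable_add) auto
  show "norm (f t) \<le> 1 + (norm (f t))\<^sup>2" for t
  proof -
    have "2 * norm (f t) * 1 \<le> (norm (f t))\<^sup>2 + 1\<^sup>2" by (rule sum_squares_bound)
    then show ?thesis using norm_ge_zero[of "f t"] by (simp del: norm_ge_zero)
  qed
qed (use L2_measurable[OF assms] in auto)

lemma L2_inner_integral:
  fixes f g :: "real \<Rightarrow> 'a::euclidean_space"
  assumes "L2 (lebesgue_on {a..b}) f" "L2 (lebesgue_on {a..b}) g"
  shows "(\<lambda>t. f t \<bullet> g t) integrable_on {a..b}"
    and "(\<integral>t. f t \<bullet> g t \<partial>lebesgue_on {a..b}) = integral {a..b} (\<lambda>t. f t \<bullet> g t)"
  using L2_inner_integrable[OF assms]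
  by (auto intro: integrable_on_lebesgue_on lebesgue_integral_eq_integral)

lemma L2_indicator:
  fixes i :: "'a::euclidean_space"
  shows "L2 (lebesgue_on {a..b}) (\<lambda>t. indicator {x..y::real} t *\<^sub>R i)"
proof -
  have "(\<lambda>t. indicator {x..y::real} t *\<^sub>R i) \<in> borel_measurable borel" by measurable
  then have "(\<lambda>t. indicator {x..y::real} t *\<^sub>R i) \<in> borel_measurable (lebesgue_on {a..b})"
    by (intro measurable_restrict_space1 measurable_completion) simp
  moreover have "(\<lambda>t. if t \<in> {x..y} then (norm i)\<^sup>2 else 0) integrable_on {a..b}"
    unfolding Henstock_Kurzweil_Integration.integrable_restrict_Int Int_atLeastAtMost
    by (intro integrable_continuous_interval continuous_intros)
  moreover have "(\<lambda>t. (norm (indicator {x..y} t *\<^sub>R i))\<^sup>2) = (\<lambda>t. if t \<in> {x..y} then (norm i)\<^sup>2 else 0)"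
    by (auto simp: indicator_def fun_eq_iff)
  ultimately show ?thesis by (intro L2_lebesgue_onI) simp_all
qed

text \<open>These pairings read off the increments of a primitive, so that prescribing the primitive
  of an L2 function becomes a family of linear constraints.\<close>

lemma L2_integral_indicator:
  fixes f :: "real \<Rightarrow> 'a::euclidean_space"
  assumes f: "L2 (lebesgue_on {a..b}) f" and "a \<le> x" "y \<le> b"
  shows "f integrable_on {x..y}"
    and "(\<integral>t. f t \<bullet> (indicator {x..y} t *\<^sub>R i) \<partial>lebesgue_on {a..b}) = integral {x..y} f \<bullet> i"
proof -
  have fi: "f integrable_on {a..b}"
    using L2_absolutely_integrable[OF f] by (simp add: absolutely_integrable_on_def)
  then show fxy: "f integrable_on {x..y}"
    by (rule integrable_on_subinterval) (use assms in auto)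
  have "(\<integral>t. f t \<bullet> (indicator {x..y} t *\<^sub>R i) \<partial>lebesgue_on {a..b}) = integral {a..b} (\<lambda>t. f t \<bullet> (indicator {x..y} t *\<^sub>R i))"
    by (rule L2_inner_integral(2)[OF f L2_indicator])
  also have "\<dots> = integral {a..b} (\<lambda>t. if t \<in> {x..y} then f t \<bullet> i else 0)"
    by (rule arg_cong[where f="integral _"]) (auto simp: indicator_def fun_eq_iff)
  also have "\<dots> = integral ({x..y} \<inter> {a..b}) (\<lambda>t. f t \<bullet> i)"
    by (rule Henstock_Kurzweil_Integration.integral_restrict_Int)
  also have "{x..y} \<inter> {a..b} = {x..y}" using assms by auto
  also have "integral {x..y} (\<lambda>t. f t \<bullet> i) = integral {x..y} f \<bullet> i"
    by (rule integral_component_eq[OF fxy])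
  finally show "(\<integral>t. f t \<bullet> (indicator {x..y} t *\<^sub>R i) \<partial>lebesgue_on {a..b}) = integral {x..y} f \<bullet> i" .
qed

lemma W22_L2_d2:
  assumes "W22 \<gamma>"
  shows "L2 (lebesgue_on {0..1}) (d2 \<gamma>)"
proof (intro L2_lebesgue_onI integrable_imp_measurable)
  show "d2 \<gamma> integrable_on {0..1}"
    using W22_d2_integral(1)[OF assms, of 0 1] by (auto simp: integrable_on_def)
qed (rule W22_d2_integral(2)[OF assms])

text \<open>Cauchy-Schwarz against the indicator of [x,y] times the integral v itself, followed by
  cancelling one factor \<open>norm v\<close>. For \<open>d2\<close> this is the embedding of W22
  into curves with 1/2-Hoelder velocity.\<close>

lemma norm_integral_le_sqrt:
  fixes f :: "real \<Rightarrow> 'a::euclidean_space"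
  assumes f: "L2 (lebesgue_on {a..b}) f" and xy: "a \<le> x" "x \<le> y" "y \<le> b"
  shows "norm (integral {x..y} f) \<le> sqrt (y - x) * sqrt (L2_sq (lebesgue_on {a..b}) f)"
proof -
  let ?M = "lebesgue_on {a..b}"
  define v where "v = integral {x..y} f"
  have "L2_sq ?M (\<lambda>t. indicator {x..y} t *\<^sub>R v) = integral {a..b} (\<lambda>t. if t \<in> {x..y} then (norm v)\<^sup>2 else 0)"
    unfolding L2_lebesgue_on_sq(2)[OF L2_indicator]
    by (rule arg_cong[where f="integral _"]) (auto simp: indicator_def fun_eq_iff)
  also have "\<dots> = integral ({x..y} \<inter> {a..b}) (\<lambda>t. (norm v)\<^sup>2)"
    by (rule Henstock_Kurzweil_Integration.integral_restrict_Int)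
  also have "{x..y} \<inter> {a..b} = {x..y}" using xy by auto
  finally have sq: "L2_sq ?M (\<lambda>t. indicator {x..y} t *\<^sub>R v) = (y - x) * (norm v)\<^sup>2"
    using xy by simp
  have "(norm v)\<^sup>2 = \<bar>\<integral>t. f t \<bullet> (indicator {x..y} t *\<^sub>R v) \<partial>?M\<bar>"
    using L2_integral_indicator(2)[OF f xy(1,3), of v] by (simp add: v_def power2_norm_eq_inner)
  also have "\<dots> \<le> sqrt (L2_sq ?M f) * sqrt (L2_sq ?M (\<lambda>t. indicator {x..y} t *\<^sub>R v))"
    by (rule L2_Cauchy_Schwarz[OF f L2_indicator])
  also have "\<dots> = (sqrt (y - x) * sqrt (L2_sq ?M f)) * norm v"
    by (simp add: sq real_sqrt_mult)
  finally have "norm v * norm v \<le> (sqrt (y - x) * sqrt (L2_sq ?M f)) * norm v"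
    by (simp add: power2_eq_square)
  then show ?thesis
    using xy L2_sq_nonneg[of ?M f] by (cases "norm v = 0") (auto simp: v_def[symmetric])
qed

section \<open>Finiteness of the tangent-point energy\<close>

lemma compact_pos_lower_bound:
  fixes f :: "'a::topological_space \<Rightarrow> real"
  assumes "compact S" "continuous_on S f" "\<And>x. x \<in> S \<Longrightarrow> 0 < f x"
  obtains m where "0 < m" "\<And>x. x \<in> S \<Longrightarrow> m \<le> f x"
proof (cases "S = {}")
  case True
  then show ?thesis using that[of 1] by auto
next
  case False
  then obtain x where "x \<in> S" "\<And>y. y \<in> S \<Longrightarrow> f x \<le> f y"
    using continuous_attains_inf[OF assms(1) _ assms(2)] by blast
  then show ?thesis using that[of "f x"] assms(3) by auto
qed

text \<open>For close parameters the velocity is nearly constant and bounded away from 0; for the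
  others compactness and injectivity give a positive minimum. Parameters at most 1/2 apart are
  compared, t possibly leaving [0,1], because at that distance equal points of the closed curve
  force equal parameters.\<close>

lemma chord_arc_bound:
  assumes W: "W22 \<gamma>" and reg: "\<And>t. d1 \<gamma> t \<noteq> 0" and inj: "inj_on \<gamma> {0..<1}"
  obtains c where "0 < c" "\<And>s t. s \<in> {0..1} \<Longrightarrow> \<bar>t - s\<bar> \<le> 1/2 \<Longrightarrow> c * \<bar>t - s\<bar> \<le> norm (\<gamma> t - \<gamma> s)"
proof -
  have cont1: "continuous_on S (d1 \<gamma>)" for S by (rule W22_continuous_d1[OF W])
  obtain m where m: "0 < m" "\<And>t. t \<in> {-1..2} \<Longrightarrow> m \<le> norm (d1 \<gamma> t)"
    using compact_pos_lower_bound[of "{-1..2::real}" "\<lambda>t. norm (d1 \<gamma> t)"] reg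
    by (metis compact_Icc cont1 continuous_on_norm zero_less_norm_iff)
  have "uniformly_continuous_on {-1..2} (d1 \<gamma>)"
    by (rule compact_uniformly_continuous[OF cont1]) simp
  then obtain \<delta> where \<delta>: "0 < \<delta>"
    "\<And>x y. x \<in> {-1..2} \<Longrightarrow> y \<in> {-1..2} \<Longrightarrow> dist y x < \<delta> \<Longrightarrow> dist (d1 \<gamma> y) (d1 \<gamma> x) < m / 2"
    using m(1) unfolding uniformly_continuous_on_def by (metis half_gt_zero)
  have near: "m / 2 * \<bar>t - s\<bar> \<le> norm (\<gamma> t - \<gamma> s)" if s: "s \<in> {0..1}" and t: "\<bar>t - s\<bar> \<le> 1/2" "\<bar>t - s\<bar> < \<delta>" for s t
  proof -
    have "norm (\<gamma> t - \<gamma> s - (t - s) *\<^sub>R d1 \<gamma> s) \<le> norm (t - s) * (m / 2)"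
    proof (rule vector_differentiable_bound_linearization[where S="closed_segment s t"])
      show "(\<gamma> has_vector_derivative d1 \<gamma> x) (at x within closed_segment s t)" for x
        by (rule has_vector_derivative_at_within[OF W22_d1[OF W]])
      show "norm (d1 \<gamma> x - d1 \<gamma> s) \<le> m / 2" if "x \<in> closed_segment s t" for x
      proof -
        have "\<bar>x - s\<bar> \<le> \<bar>t - s\<bar>" using that by (auto simp: closed_segment_eq_real_ivl split: if_splits)
        then have "dist (d1 \<gamma> x) (d1 \<gamma> s) < m / 2"
          using s t by (intro \<delta>(2)) (auto simp: dist_real_def abs_le_iff)
        then show ?thesis by (simp add: dist_norm)
      qed
    qed auto
    moreover have "m * \<bar>t - s\<bar> \<le> norm ((t - s) *\<^sub>R d1 \<gamma> s)"
      using m(2)[of s] s mult_right_mono[of m "norm (d1 \<gamma> s)" "\<bar>t - s\<bar>"] by (simp add: mult.commute)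
    moreover have "norm ((t - s) *\<^sub>R d1 \<gamma> s) \<le> norm (\<gamma> t - \<gamma> s) + norm (\<gamma> t - \<gamma> s - (t - s) *\<^sub>R d1 \<gamma> s)"
      using norm_triangle_ineq4[of "\<gamma> t - \<gamma> s" "\<gamma> t - \<gamma> s - (t - s) *\<^sub>R d1 \<gamma> s"] by simp
    ultimately show ?thesis by (simp add: field_simps)
  qed
  define K where "K = ({0..1} \<times> {-1..2}) \<inter> (\<lambda>(s, t). \<bar>t - s\<bar>) -` {\<delta>..1/2::real}"
  have "closed ((\<lambda>(s, t). \<bar>t - s\<bar>) -` {\<delta>..1/2::real})"
    by (intro closed_vimage) (auto simp: split_beta intro!: continuous_intros)
  then have K1: "compact K"
    unfolding K_def by (intro compact_Int_closed compact_Times) auto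
  have K2: "continuous_on K (\<lambda>(s, t). norm (\<gamma> t - \<gamma> s))"
    unfolding split_beta
    by (intro continuous_intros continuous_on_compose2[OF W22_continuous[OF W, of UNIV]]) auto
  have K3: "0 < (case p of (s, t) \<Rightarrow> norm (\<gamma> t - \<gamma> s))" if "p \<in> K" for p
  proof -
    obtain s t where p: "p = (s, t)" by (cases p)
    have st: "\<delta> \<le> \<bar>t - s\<bar>" "\<bar>t - s\<bar> \<le> 1/2" using that by (auto simp: K_def p)
    have "\<gamma> t \<noteq> \<gamma> s"
    proof
      assume eq: "\<gamma> t = \<gamma> s"
      have fr: "\<gamma> (frac x) = \<gamma> x" for x
        using periodic_shift_int[of \<gamma> "frac x" "\<lfloor>x\<rfloor>"] W22_periodic[OF W] by (simp add: frac_def)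
      have "frac t = frac s"
        using inj_onD[OF inj, of "frac t" "frac s"] eq fr by (auto simp: frac_lt_1)
      then obtain z :: int where z: "t - s = of_int z"
        using that[of "\<lfloor>t\<rfloor> - \<lfloor>s\<rfloor>"] by (simp add: frac_def)
      then have "z = 0" using st(2) by linarith
      then show False using z st(1) \<delta>(1) by simp
    qed
    then show ?thesis by (simp add: p)
  qed
  obtain \<mu> where \<mu>: "0 < \<mu>" "\<And>p. p \<in> K \<Longrightarrow> \<mu> \<le> (case p of (s, t) \<Rightarrow> norm (\<gamma> t - \<gamma> s))"
    by (rule compact_pos_lower_bound[OF K1 K2], erule K3) (rule that)
  have "min (m / 2) \<mu> * \<bar>t - s\<bar> \<le> norm (\<gamma> t - \<gamma> s)" if s: "s \<in> {0..1}" and t: "\<bar>t - s\<bar> \<le> 1/2" for s t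
  proof (cases "\<bar>t - s\<bar> < \<delta>")
    case True
    have "min (m / 2) \<mu> * \<bar>t - s\<bar> \<le> m / 2 * \<bar>t - s\<bar>" by (intro mult_right_mono) auto
    also have "\<dots> \<le> norm (\<gamma> t - \<gamma> s)" by (rule near[OF s t True])
    finally show ?thesis .
  next
    case False
    moreover have "-1 \<le> t" "t \<le> 2" using s t unfolding abs_le_iff atLeastAtMost_iff by linarith+
    ultimately have "(s, t) \<in> K" using s t by (auto simp: K_def)
    then have "\<mu> \<le> norm (\<gamma> t - \<gamma> s)" using \<mu>(2)[of "(s, t)"] by simp
    moreover have "min (m / 2) \<mu> * \<bar>t - s\<bar> \<le> \<mu> * 1"
      using t \<mu>(1) m(1) by (intro mult_mono) auto
    ultimately show ?thesis by simp
  qed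
  moreover have "0 < min (m / 2) \<mu>" using m(1) \<mu>(1) by simp
  ultimately show ?thesis using that by blast
qed

text \<open>The window [-1,2] contains every t within 1/2 of some s in [0,1], the range on which the
  chord-arc bound is used.\<close>

lemma W22_d2_sq_integrable:
  assumes "W22 \<gamma>"
  shows "(\<lambda>t. (norm (d2 \<gamma> t))\<^sup>2) integrable_on {-1..2}"
proof -
  let ?f = "\<lambda>t. (norm (d2 \<gamma> t))\<^sup>2"
  have f0: "?f integrable_on {0..1}" by (rule W22_d2_integral(2)[OF assms])
  have per: "?f (of_int n + t) = ?f t" for n t
    using periodic_shift_int[of "d2 \<gamma>" t n] d2_periodic[of \<gamma>] W22_periodic[OF assms] by (simp add: add.commute)
  have "?f integrable_on {0 + of_int n..1 + of_int n}" for n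
    using integrable_on_shift_Icc_real[of ?f "of_int n" 0 1] f0 per[of n] by (simp add: o_def)
  from this[of "-1"] this[of 1] have "?f integrable_on {-1..0}" "?f integrable_on {1..2}" by simp_all
  with f0 have "?f integrable_on {-1..1}"
    by (intro Henstock_Kurzweil_Integration.integrable_combine[of "-1" 0 1]) auto
  with \<open>?f integrable_on {1..2}\<close> show ?thesis
    by (intro Henstock_Kurzweil_Integration.integrable_combine[of "-1" 1 2]) auto
qed

lemma W22_norm_d2_integrable:
  assumes "W22 \<gamma>"
  shows "(\<lambda>t. norm (d2 \<gamma> t)) integrable_on {-1..2}"
proof -
  have "d2 \<gamma> \<in> borel_measurable (lebesgue_on {-1..2})"
    using W22_d2_integral(1)[OF assms, of "-1" 2] by (intro integrable_imp_measurable) (auto simp: integrable_on_def)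
  then have "d2 \<gamma> absolutely_integrable_on {-1..2}"
    by (intro L2_absolutely_integrable L2_lebesgue_onI W22_d2_sq_integrable[OF assms])
  then show ?thesis by (simp add: absolutely_integrable_on_def)
qed

lemma norm_cross3_le: "norm (cross3 x y) \<le> norm x * norm y"
proof (rule power2_le_imp_le)
  show "(norm (cross3 x y))\<^sup>2 \<le> (norm x * norm y)\<^sup>2"
    by (simp add: norm_cross power_mult_distrib)
qed simp

text \<open>The cross product annihilates the tangential part of the chord, leaving the first-order
  Taylor remainder, which is at most |t-s| times the integral of \<open>norm (d2 \<gamma> r)\<close>
  between the parameters. The squared chord in the denominator contributes |t-s|^2, so a mean
  remains. The interval is written from its left end to match
  \<open>initial_average\<close>.\<close>

lemma inv_rtp_le:
  assumes W: "W22 \<gamma>" and "d1 \<gamma> s \<noteq> 0" and c: "0 < c" "c * \<bar>t - s\<bar> \<le> norm (\<gamma> t - \<gamma> s)" and "t \<noteq> s"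
    and "s \<in> {-1..2}" "t \<in> {-1..2}"
  shows "inv_rtp (\<gamma> s) (d1 \<gamma> s) (\<gamma> t)
    \<le> 2 / c\<^sup>2 * (integral {min s t..min s t + \<bar>t - s\<bar>} (\<lambda>r. norm (d2 \<gamma> r)) * (1 / \<bar>t - s\<bar>))"
proof -
  let ?S = "{min s t..min s t + \<bar>t - s\<bar>}"
  have S_eq: "closed_segment s t = ?S" by (auto simp: closed_segment_eq_real_ivl min_def)
  define I where "I = integral ?S (\<lambda>r. norm (d2 \<gamma> r))"
  have int: "(\<lambda>r. norm (d2 \<gamma> r)) integrable_on {x..y}" if "-1 \<le> x" "y \<le> 2" for x y
    using W22_norm_d2_integrable[OF W] by (rule integrable_on_subinterval) (use that in auto)
  have diff: "norm (d1 \<gamma> y - d1 \<gamma> x) \<le> I" if "x \<le> y" "x \<in> ?S" "y \<in> ?S" for x y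
  proof -
    have xy: "-1 \<le> x" "y \<le> 2" using assms(6,7) that by (auto simp: min_def split: if_splits)
    have h: "(d2 \<gamma> has_integral d1 \<gamma> y - d1 \<gamma> x) {x..y}" by (rule W22_d2_integral(1)[OF W \<open>x \<le> y\<close>])
    have "norm (integral {x..y} (d2 \<gamma>)) \<le> integral {x..y} (\<lambda>r. norm (d2 \<gamma> r))"
      using h by (intro integral_norm_bound_integral int xy) (auto simp: integrable_on_def)
    also have "\<dots> \<le> I"
      unfolding I_def using that assms(6,7) xy
      by (intro integral_subset_le int) (auto simp: min_def split: if_splits)
    finally show ?thesis using integral_unique[OF h] by simp
  qed
  have I0: "0 \<le> I" using diff[of s s] by (auto simp: min_def)
  let ?v = "\<gamma> t - \<gamma> s - (t - s) *\<^sub>R d1 \<gamma> s"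
  have v: "norm ?v \<le> norm (t - s) * I"
  proof (rule vector_differentiable_bound_linearization[where S="closed_segment s t"])
    show "(\<gamma> has_vector_derivative d1 \<gamma> x) (at x within closed_segment s t)" for x
      by (rule has_vector_derivative_at_within[OF W22_d1[OF W]])
    show "norm (d1 \<gamma> x - d1 \<gamma> s) \<le> I" if "x \<in> closed_segment s t" for x
      using diff[of s x] diff[of x s] that ends_in_segment(1)[of s t] unfolding S_eq
      by (cases "s \<le> x") (auto simp: norm_minus_commute)
  qed auto
  have "cross3 (\<gamma> t - \<gamma> s) (d1 \<gamma> s) = cross3 ?v (d1 \<gamma> s)"
    by (simp add: cross3_simps cross_mult_left)
  then have "norm (cross3 (\<gamma> t - \<gamma> s) (d1 \<gamma> s)) \<le> norm ?v * norm (d1 \<gamma> s)"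
    by (simp add: norm_cross3_le)
  then have num: "norm (cross3 (\<gamma> t - \<gamma> s) (d1 \<gamma> s)) \<le> \<bar>t - s\<bar> * I * norm (d1 \<gamma> s)"
    using mult_right_mono[OF v, of "norm (d1 \<gamma> s)"] by simp
  have den: "(c * \<bar>t - s\<bar>)\<^sup>2 \<le> (norm (\<gamma> t - \<gamma> s))\<^sup>2"
    using c by (intro power_mono) auto
  have pos: "0 < (c * \<bar>t - s\<bar>)\<^sup>2" using c \<open>t \<noteq> s\<close> by simp
  have "inv_rtp (\<gamma> s) (d1 \<gamma> s) (\<gamma> t) \<le> 2 * (\<bar>t - s\<bar> * I * norm (d1 \<gamma> s)) / (norm (d1 \<gamma> s) * (c * \<bar>t - s\<bar>)\<^sup>2)"
    unfolding inv_rtp_def using num den pos assms(2) I0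
    by (intro frac_le mult_left_mono) auto
  also have "\<dots> = 2 / c\<^sup>2 * (I * (1 / \<bar>t - s\<bar>))"
  proof -
    have *: "2 * (d * I * n) / (n * (c * d)\<^sup>2) = 2 / c\<^sup>2 * (I * (1 / d))" if "0 < n" "0 < d" for n d :: real
      using that c(1) by (simp add: power2_eq_square field_simps)
    show ?thesis by (rule *) (use assms(2) \<open>t \<noteq> s\<close> in auto)
  qed
  finally show ?thesis by (simp add: I_def)
qed

theorem tp_energy_finite:
  assumes W: "W22 \<gamma>" and reg: "\<And>t. d1 \<gamma> t \<noteq> 0" and inj: "inj_on \<gamma> {0..<1}" and q: "0 < q" "q \<le> 4"
  shows "tp_energy q \<gamma> < \<infinity>"
proof -
  let ?S = "{-1..2::real}" and ?n = "\<lambda>x. norm (d2 \<gamma> x)"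
  obtain c where c: "0 < c" "\<And>s t. s \<in> {0..1} \<Longrightarrow> \<bar>t - s\<bar> \<le> 1/2 \<Longrightarrow> c * \<bar>t - s\<bar> \<le> norm (\<gamma> t - \<gamma> s)"
    using chord_arc_bound[OF W reg inj] by blast
  have "bounded (d1 \<gamma> ` {0..1})"
    by (intro compact_imp_bounded compact_continuous_image W22_continuous_d1[OF W]) simp
  then obtain B where B: "0 < B" "\<And>t. t \<in> {0..1} \<Longrightarrow> norm (d1 \<gamma> t) \<le> B"
    unfolding bounded_pos by auto
  have int: "?n integrable_on {a..b}" if "-1 \<le> a" "b \<le> 2" for a b
    using W22_norm_d2_integrable[OF W] by (rule integrable_on_subinterval) (use that in auto)
  \<comment> \<open>The Hardy estimates concern Borel functions, while \<open>d2\<close> is only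
    known to be Lebesgue measurable; the f obtained below is a Borel version of its norm, cut off to
    the window.\<close>
  define g where "g x = ennreal (if x \<in> ?S then ?n x else 0)" for x
  have "(\<lambda>x. if x \<in> ?S then ?n x else 0) integrable_on UNIV"
    unfolding integrable_restrict_UNIV by (rule W22_norm_d2_integrable[OF W])
  then have "(\<lambda>x. if x \<in> ?S then ?n x else 0) \<in> borel_measurable lebesgue"
    using integrable_imp_measurable lebesgue_on_UNIV_eq by metis
  then have "g \<in> borel_measurable lebesgue"
    unfolding g_def[abs_def] by measurable
  then obtain f where f: "f \<in> borel_measurable lborel" "AE x in lborel. g x = f x"
    using completion_ex_borel_measurable by blast
  have [measurable]: "f \<in> borel_measurable borel" using f(1) by simp
  have "(\<integral>\<^sup>+x. f x \<partial>lborel) = (\<integral>\<^sup>+x. indicator ?S x * ennreal (?n x) \<partial>lborel)"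
  proof (rule nn_integral_cong_AE)
    show "AE x in lborel. f x = indicator ?S x * ennreal (?n x)"
      using f(2) by eventually_elim (auto simp: g_def indicator_def split: if_splits)
  qed
  also have "\<dots> = ennreal (integral ?S ?n)"
    by (rule nn_integral_indicator_has_integral) (auto intro: integrable_integral W22_norm_d2_integrable[OF W])
  finally have fin: "(\<integral>\<^sup>+x. f x \<partial>lborel) < \<infinity>" by simp
  have "(\<integral>\<^sup>+x. (f x)\<^sup>2 \<partial>lborel) = (\<integral>\<^sup>+x. indicator ?S x * ennreal ((?n x)\<^sup>2) \<partial>lborel)"
  proof (rule nn_integral_cong_AE)
    show "AE x in lborel. (f x)\<^sup>2 = indicator ?S x * ennreal ((?n x)\<^sup>2)"
      using f(2) by eventually_elim (auto simp: g_def indicator_def ennreal_power[symmetric] split: if_splits)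
  qed
  also have "\<dots> = ennreal (integral ?S (\<lambda>x. (?n x)\<^sup>2))"
    by (rule nn_integral_indicator_has_integral) (auto intro: integrable_integral W22_d2_sq_integrable[OF W])
  finally have fin2: "(\<integral>\<^sup>+x. (f x)\<^sup>2 \<partial>lborel) < \<infinity>" by simp
  have mass: "initial_mass (\<lambda>y. f (a + y)) h = ennreal (integral {a..a + h} ?n)" if "-1 \<le> a" "0 \<le> h" "a + h \<le> 2" for a h
  proof -
    have "(\<integral>\<^sup>+x. (if a < x \<and> x < a + h then f x else 0) \<partial>lborel)
        = \<bar>1::real\<bar> * (\<integral>\<^sup>+y. (if a < a + 1 * y \<and> a + 1 * y < a + h then f (a + 1 * y) else 0) \<partial>lborel)"
      by (rule nn_integral_real_affine) auto
    then have "initial_mass (\<lambda>y. f (a + y)) h = (\<integral>\<^sup>+x. (if a < x \<and> x < a + h then f x else 0) \<partial>lborel)"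
      unfolding initial_mass_def mult_1 by simp
    also have "\<dots> = (\<integral>\<^sup>+x. indicator {a..a + h} x * ennreal (?n x) \<partial>lborel)"
    proof (rule nn_integral_cong_AE)
      show "AE x in lborel. (if a < x \<and> x < a + h then f x else 0) = indicator {a..a + h} x * ennreal (?n x)"
        using f(2) AE_lborel_singleton[of a] AE_lborel_singleton[of "a + h"]
        by eventually_elim (use that in \<open>auto simp: g_def indicator_def split: if_splits\<close>)
    qed
    also have "\<dots> = ennreal (integral {a..a + h} ?n)"
      by (rule nn_integral_indicator_has_integral) (use that in \<open>auto intro: integrable_integral int\<close>)
    finally show ?thesis .
  qed
  define U where "U a h = initial_average (\<lambda>y. f (a + y)) h" for a h
  have [measurable]: "case_prod U \<in> borel_measurable (borel \<Otimes>\<^sub>M borel)"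
    unfolding U_def initial_average_def initial_mass_def by measurable
  \<comment> \<open>Fourth power of the mean of f between s and t, in either order; at most one
    summand is nonzero, so each half of the square contributes \<open>?P\<close>.\<close>
  define V where "V s t = (if s < t then U s (t - s) ^ 4 else 0) + (if t < s then U t (s - t) ^ 4 else 0)" for s t
  have [measurable]: "case_prod V \<in> borel_measurable (borel \<Otimes>\<^sub>M borel)"
    unfolding V_def by measurable
  let ?P = "\<integral>\<^sup>+s. \<integral>\<^sup>+h. (if 0 < h then U s h ^ 4 else 0) \<partial>lborel \<partial>lborel"
  have "?P \<le> 1024 * (\<integral>\<^sup>+x. (f x)\<^sup>2 \<partial>lborel)\<^sup>2"
    unfolding U_def by (rule nn_integral_average_power4_le[OF _ fin]) simp
  also have "\<dots> < \<infinity>"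
    using fin2 by (simp add: ennreal_mult_less_top power_less_top_ennreal)
  finally have P: "?P < \<infinity>" .
  have shift: "(\<integral>\<^sup>+t. G (t + k) \<partial>lborel) = (\<integral>\<^sup>+t. G t \<partial>lborel)"
    if [measurable]: "G \<in> borel_measurable borel" for G :: "real \<Rightarrow> ennreal" and k
    using nn_integral_real_affine[of G 1 k] that by (simp add: add.commute)
  have half: "(\<integral>\<^sup>+s. \<integral>\<^sup>+t. (if s < t then U s (t - s) ^ 4 else 0) \<partial>lborel \<partial>lborel) = ?P"
  proof (rule nn_integral_cong)
    fix s
    show "(\<integral>\<^sup>+t. (if s < t then U s (t - s) ^ 4 else 0) \<partial>lborel) = (\<integral>\<^sup>+h. (if 0 < h then U s h ^ 4 else 0) \<partial>lborel)"
      using shift[of "\<lambda>h. (if 0 < h then U s h ^ 4 else 0)" "- s"] by (simp cong: if_cong)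
  qed
  have half': "(\<integral>\<^sup>+s. \<integral>\<^sup>+t. (if t < s then U t (s - t) ^ 4 else 0) \<partial>lborel \<partial>lborel) = ?P"
    unfolding half[symmetric] by (rule lborel_pair.Fubini') measurable
  have "(\<integral>\<^sup>+s. \<integral>\<^sup>+t. V s t \<partial>lborel \<partial>lborel) = ?P + ?P"
  proof -
    have "(\<integral>\<^sup>+t. V s t \<partial>lborel) = (\<integral>\<^sup>+t. (if s < t then U s (t - s) ^ 4 else 0) \<partial>lborel)
       + (\<integral>\<^sup>+t. (if t < s then U t (s - t) ^ 4 else 0) \<partial>lborel)" for s
      unfolding V_def by (rule nn_integral_add) measurable
    then have "(\<integral>\<^sup>+s. \<integral>\<^sup>+t. V s t \<partial>lborel \<partial>lborel) = (\<integral>\<^sup>+s. (\<integral>\<^sup>+t. (if s < t then U s (t - s) ^ 4 else 0) \<partial>lborel)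
       + (\<integral>\<^sup>+t. (if t < s then U t (s - t) ^ 4 else 0) \<partial>lborel) \<partial>lborel)" by simp
    also have "\<dots> = ?P + ?P"
      by (subst nn_integral_add) (simp_all add: half half')
    finally show ?thesis .
  qed
  with P have V_fin: "(\<integral>\<^sup>+s. \<integral>\<^sup>+t. V s t \<partial>lborel \<partial>lborel) < \<infinity>" by simp
  define D where "D = ennreal ((2 / c\<^sup>2) ^ 4)"
  have inv0: "0 \<le> inv_rtp x \<tau> y" for x \<tau> y by (simp add: inv_rtp_def)
  have near: "ennreal (inv_rtp (\<gamma> s) (d1 \<gamma> s) (\<gamma> t) ^ 4) \<le> D * V s t" if s: "s \<in> {0..1}" and t: "\<bar>t - s\<bar> \<le> 1/2" for s t
  proof (cases "t = s")
    case True
    then show ?thesis by (simp add: inv_rtp_def)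
  next
    case False
    let ?I = "integral {min s t..min s t + \<bar>t - s\<bar>} ?n"
    have "inv_rtp (\<gamma> s) (d1 \<gamma> s) (\<gamma> t) \<le> 2 / c\<^sup>2 * (?I * (1 / \<bar>t - s\<bar>))"
    proof (intro inv_rtp_le W reg c s t)
      show "s \<in> {-1..2}" "t \<in> {-1..2}"
        using s t unfolding abs_le_iff atLeastAtMost_iff by linarith+
    qed (use False in auto)
    then have "inv_rtp (\<gamma> s) (d1 \<gamma> s) (\<gamma> t) ^ 4 \<le> (2 / c\<^sup>2 * (?I * (1 / \<bar>t - s\<bar>))) ^ 4"
      by (intro power_mono inv0)
    then have "ennreal (inv_rtp (\<gamma> s) (d1 \<gamma> s) (\<gamma> t) ^ 4) \<le> ennreal ((2 / c\<^sup>2 * (?I * (1 / \<bar>t - s\<bar>))) ^ 4)"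
      by (rule ennreal_leI)
    also have "\<dots> = D * (ennreal ?I * ennreal (1 / \<bar>t - s\<bar>)) ^ 4"
    proof -
      have I0: "0 \<le> ?I"
        using s t by (intro Henstock_Kurzweil_Integration.integral_nonneg int) (auto simp: abs_le_iff min_def)
      then show ?thesis
        unfolding D_def power_mult_distrib by (simp add: ennreal_mult ennreal_power)
    qed
    also have "ennreal ?I = initial_mass (\<lambda>y. f (min s t + y)) \<bar>t - s\<bar>"
      using s t by (intro mass[symmetric]) (auto simp: abs_le_iff min_def)
    also have "(initial_mass (\<lambda>y. f (min s t + y)) \<bar>t - s\<bar> * ennreal (1 / \<bar>t - s\<bar>)) ^ 4 = U (min s t) \<bar>t - s\<bar> ^ 4"
      by (simp add: U_def initial_average_def)
    also have "\<dots> = V s t"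
      using False by (cases "s < t") (auto simp: V_def min_def)
    finally show ?thesis .
  qed
  \<comment> \<open>Points s and t of [0,1] may be a full period apart, whereas \<open>near\<close>
    needs distance at most 1/2. One of t-1, t, t+1 always qualifies, and adding all three values of
    V avoids selecting it.\<close>
  have pointwise: "ennreal (inv_rtp (\<gamma> s) (d1 \<gamma> s) (\<gamma> t) powr q * norm (d1 \<gamma> s) * norm (d1 \<gamma> t))
      \<le> ennreal (B * B) * (1 + D * (V s (t + -1) + V s t + V s (t + 1)))"
    if s: "s \<in> {0..1}" and t: "t \<in> {0..1}" for s t
  proof -
    define r where "r = inv_rtp (\<gamma> s) (d1 \<gamma> s) (\<gamma> t)"
    have r0: "0 \<le> r" by (simp add: r_def inv0)
    \<comment> \<open>Reduces all exponents to the critical one; the summand 1 covers r <=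
      1.\<close>
    have "r powr q \<le> 1 + r ^ 4"
    proof (cases "r \<le> 1")
      case True
      then have "r powr q \<le> 1 powr q" using r0 q by (intro powr_mono2) auto
      moreover have "0 \<le> r ^ 4" using r0 by (rule zero_le_power)
      ultimately show ?thesis unfolding powr_one_eq_one by linarith
    next
      case False
      then have "r powr q \<le> r powr 4" using q by (intro powr_mono) auto
      then show ?thesis using False by simp
    qed
    then have "r powr q * norm (d1 \<gamma> s) * norm (d1 \<gamma> t) \<le> (1 + r ^ 4) * B * B"
      using B s t r0 by (intro mult_mono) auto
    then have "ennreal (r powr q * norm (d1 \<gamma> s) * norm (d1 \<gamma> t)) \<le> ennreal (B * B * (1 + r ^ 4))"
      by (intro ennreal_leI) (simp add: mult_ac)
    also have "\<dots> = ennreal (B * B) * (1 + ennreal (r ^ 4))"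
      using B(1) r0 by (simp add: ennreal_mult)
    also have "ennreal (r ^ 4) \<le> D * (V s (t + -1) + V s t + V s (t + 1))"
    proof -
      consider "\<bar>t - 1 - s\<bar> \<le> 1/2" | "\<bar>t - s\<bar> \<le> 1/2" | "\<bar>t + 1 - s\<bar> \<le> 1/2"
        using s t unfolding abs_le_iff by fastforce
      then show ?thesis
      proof cases
        case 1
        have "\<gamma> (t - 1) = \<gamma> t" using W22_periodic[OF W, of "t - 1"] by simp
        then have "ennreal (r ^ 4) \<le> D * V s (t - 1)" using near[OF s 1] by (simp add: r_def)
        also have "\<dots> \<le> D * (V s (t + -1) + V s t + V s (t + 1))"
          by (intro mult_left_mono) (auto simp: add.assoc)
        finally show ?thesis .
      next
        case 2
        then have "ennreal (r ^ 4) \<le> D * V s t" using near[OF s 2] by (simp add: r_def)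
        also have "\<dots> \<le> D * (V s (t + -1) + V s t + V s (t + 1))"
          by (intro mult_left_mono) (auto simp: add.assoc add_increasing)
        finally show ?thesis .
      next
        case 3
        then have "ennreal (r ^ 4) \<le> D * V s (t + 1)" using near[OF s 3] W22_periodic[OF W, of t] by (simp add: r_def)
        also have "\<dots> \<le> D * (V s (t + -1) + V s t + V s (t + 1))"
          by (intro mult_left_mono) (auto simp: add_increasing)
        finally show ?thesis .
      qed
    qed
    finally show ?thesis by (simp add: r_def mult_left_mono add_left_mono)
  qed
  have "tp_energy q \<gamma> \<le> (\<integral>\<^sup>+s. \<integral>\<^sup>+t. ennreal (B * B) * indicator {0..1::real} s * indicator {0..1::real} t
      + ennreal (B * B) * D * (V s (t + -1) + V s t + V s (t + 1)) \<partial>lborel \<partial>lborel)"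
    unfolding tp_energy_def
  proof (intro nn_integral_mono)
    fix s t
    show "indicator {0..1::real} s * indicator {0..1::real} t * ennreal (inv_rtp (\<gamma> s) (d1 \<gamma> s) (\<gamma> t) powr q * norm (d1 \<gamma> s) * norm (d1 \<gamma> t))
      \<le> ennreal (B * B) * indicator {0..1::real} s * indicator {0..1::real} t
      + ennreal (B * B) * D * (V s (t + -1) + V s t + V s (t + 1))"
      using pointwise[of s t] by (auto simp: indicator_def distrib_left mult.assoc)
  qed
  also have "\<dots> = (\<integral>\<^sup>+s. ennreal (B * B) * indicator {0..1::real} s
      + ennreal (B * B) * D * (3 * (\<integral>\<^sup>+t. V s t \<partial>lborel)) \<partial>lborel)"
  proof (rule nn_integral_cong)
    fix s
    have "(\<integral>\<^sup>+t. ennreal (B * B) * indicator {0..1::real} s * indicator {0..1::real} t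
        + ennreal (B * B) * D * (V s (t + -1) + V s t + V s (t + 1)) \<partial>lborel)
      = (\<integral>\<^sup>+t. ennreal (B * B) * indicator {0..1::real} s * indicator {0..1::real} t \<partial>lborel)
        + (\<integral>\<^sup>+t. ennreal (B * B) * D * (V s (t + -1) + V s t + V s (t + 1)) \<partial>lborel)"
      by (rule nn_integral_add) measurable
    also have "(\<integral>\<^sup>+t. ennreal (B * B) * indicator {0..1::real} s * indicator {0..1::real} t \<partial>lborel) = ennreal (B * B) * indicator {0..1::real} s"
      by (subst nn_integral_cmult) simp_all
    also have "(\<integral>\<^sup>+t. ennreal (B * B) * D * (V s (t + -1) + V s t + V s (t + 1)) \<partial>lborel)
       = ennreal (B * B) * D * (\<integral>\<^sup>+t. V s (t + -1) + V s t + V s (t + 1) \<partial>lborel)"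
      by (rule nn_integral_cmult) measurable
    also have "(\<integral>\<^sup>+t. V s (t + -1) + V s t + V s (t + 1) \<partial>lborel)
       = (\<integral>\<^sup>+t. V s (t + -1) \<partial>lborel) + (\<integral>\<^sup>+t. V s t \<partial>lborel) + (\<integral>\<^sup>+t. V s (t + 1) \<partial>lborel)"
      by (subst nn_integral_add, measurable, subst nn_integral_add, measurable)
    also have "\<dots> = 3 * (\<integral>\<^sup>+t. V s t \<partial>lborel)"
    proof -
      have "(\<integral>\<^sup>+t. V s (t + k) \<partial>lborel) = (\<integral>\<^sup>+t. V s t \<partial>lborel)" for k
        by (rule shift) measurable
      moreover have "x + x + x = 3 * x" for x :: ennreal
        by (metis mult_2 numeral_Bit1 numeral_One distrib_right mult_1 numeral_Bit0)
      ultimately show ?thesis by (simp only:)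
    qed
    finally show "(\<integral>\<^sup>+t. ennreal (B * B) * indicator {0..1::real} s * indicator {0..1::real} t
        + ennreal (B * B) * D * (V s (t + -1) + V s t + V s (t + 1)) \<partial>lborel)
      = ennreal (B * B) * indicator {0..1::real} s + ennreal (B * B) * D * (3 * (\<integral>\<^sup>+t. V s t \<partial>lborel))" .
  qed
  also have "\<dots> = (\<integral>\<^sup>+s. ennreal (B * B) * indicator {0..1::real} s \<partial>lborel)
      + (\<integral>\<^sup>+s. ennreal (B * B) * D * (3 * (\<integral>\<^sup>+t. V s t \<partial>lborel)) \<partial>lborel)"
    by (rule nn_integral_add) measurable
  also have "(\<integral>\<^sup>+s. ennreal (B * B) * indicator {0..1::real} s \<partial>lborel) = ennreal (B * B)"
    by (subst nn_integral_cmult) simp_all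
  also have "(\<integral>\<^sup>+s. ennreal (B * B) * D * (3 * (\<integral>\<^sup>+t. V s t \<partial>lborel)) \<partial>lborel)
      = ennreal (B * B) * D * (3 * (\<integral>\<^sup>+s. \<integral>\<^sup>+t. V s t \<partial>lborel \<partial>lborel))"
    by (subst nn_integral_cmult, measurable, subst nn_integral_cmult, measurable)
  also have "ennreal (B * B) + \<dots> < \<infinity>"
    using V_fin by (auto simp: D_def ennreal_mult_less_top)
  finally show ?thesis .
qed

section \<open>Compactness and lower semicontinuity\<close>

text \<open>Differentiating the constant squared speed shows that velocity and acceleration are
  orthogonal almost everywhere, so the norm of their cross product is that of \<open>d2\<close>.
  This turns the geometric energy into a squared L2 norm.\<close>

lemma bending_arclength:
  assumes W: "W22 \<gamma>" and a: "arclength \<gamma>"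
  shows "bending \<gamma> = L2_sq (lebesgue_on {0..1}) (d2 \<gamma>)"
proof -
  have int: "(d2 \<gamma> has_integral d1 \<gamma> y - d1 \<gamma> x) {x..y}" if "0 \<le> x" "x \<le> y" "y \<le> 1" for x y
    by (rule W22_d2_integral(1)[OF W \<open>x \<le> y\<close>])
  obtain N where N: "negligible N" "\<And>x. x \<in> {0..1} - N \<Longrightarrow> (d1 \<gamma> has_vector_derivative d2 \<gamma> x) (at x)"
    by (rule d2_AE_eq_density[OF _ zero_less_one], erule (2) int) (rule that)
  have n1: "norm (d1 \<gamma> t) = 1" for t using a by (simp add: arclength_def)
  have eq: "(norm (cross3 (d1 \<gamma> x) (d2 \<gamma> x)) / norm (d1 \<gamma> x) ^ 3)\<^sup>2 * norm (d1 \<gamma> x) = (norm (d2 \<gamma> x))\<^sup>2"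
    if "x \<in> {0..1} - N" for x
  proof -
    have "((\<lambda>t. d1 \<gamma> t \<bullet> d1 \<gamma> t) has_vector_derivative d1 \<gamma> x \<bullet> d2 \<gamma> x + d2 \<gamma> x \<bullet> d1 \<gamma> x) (at x)"
      by (rule bounded_bilinear.has_vector_derivative[OF bounded_bilinear_inner N(2)[OF that] N(2)[OF that]])
    moreover have "(\<lambda>t. d1 \<gamma> t \<bullet> d1 \<gamma> t) = (\<lambda>t. 1)"
      using n1 by (simp add: fun_eq_iff power2_norm_eq_inner[symmetric])
    ultimately have "d1 \<gamma> x \<bullet> d2 \<gamma> x + d2 \<gamma> x \<bullet> d1 \<gamma> x = 0"
      using vector_derivative_unique_at[of "\<lambda>t. 1::real" _ x 0] by (simp add: has_vector_derivative_const)
    then have "d1 \<gamma> x \<bullet> d2 \<gamma> x = 0" by (simp add: inner_commute)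
    then show ?thesis by (simp add: n1 norm_cross)
  qed
  have "bending \<gamma> = integral {0..1} (\<lambda>t. (norm (d2 \<gamma> t))\<^sup>2)"
    unfolding bending_def by (rule integral_spike[OF N(1)]) (simp add: eq)
  then show ?thesis
    by (simp add: L2_lebesgue_on_sq(2)[OF W22_L2_d2[OF W]])
qed

text \<open>An integrable integrand is pointwise nonnegative; otherwise \<open>integral\<close>
  takes its default value 0.\<close>

lemma bending_nonneg: "0 \<le> bending \<gamma>"
  unfolding bending_def
  by (metis (no_types, lifting) Henstock_Kurzweil_Integration.integral_nonneg mult_nonneg_nonneg norm_ge_zero
      not_integrable_integral order_refl zero_le_power2)

text \<open>Finiteness of the competitor's tangent-point energy selects the real branch of
  \<open>E_theta\<close>, and the penalty of \<gamma> is discarded. The error term depends on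
  \<beta> and \<theta> but not on \<gamma>.\<close>

lemma bending_le_of_E_theta_le:
  assumes "E_theta q \<theta> \<gamma> \<le> E_theta q \<theta> \<beta>" "tp_energy q \<beta> < \<infinity>" "0 < \<theta>"
  shows "bending \<gamma> \<le> bending \<beta> + \<theta> * enn2real (tp_energy q \<beta>) powr (1 / (q - 2))"
proof -
  have "ennreal (bending \<gamma>) \<le> E_theta q \<theta> \<gamma>"
    unfolding E_theta_def by simp
  also note assms(1)
  also have "E_theta q \<theta> \<beta> = ennreal (bending \<beta> + \<theta> * enn2real (tp_energy q \<beta>) powr (1 / (q - 2)))"
    using assms(2,3) bending_nonneg[of \<beta>] unfolding E_theta_def by (simp add: ennreal_plus[symmetric] del: ennreal_plus)
  finally show ?thesis
    using assms(3) bending_nonneg[of \<beta>] by (subst (asm) ennreal_le_iff) auto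
qed

section \<open>Limits of second derivatives\<close>

lemma tendsto_if_subseq_limits_eq:
  fixes a :: "nat \<Rightarrow> 'a::heine_borel"
  assumes bd: "bounded (range a)" and eq: "\<And>s l. strict_mono s \<Longrightarrow> (a \<circ> s) \<longlonglongrightarrow> l \<Longrightarrow> l = L"
  shows "a \<longlonglongrightarrow> L"
proof (rule ccontr)
  assume "\<not> a \<longlonglongrightarrow> L"
  then obtain e where e: "0 < e" "\<not> (\<forall>\<^sub>F n in sequentially. dist (a n) L < e)"
    unfolding tendsto_iff by blast
  then have "infinite {n. \<not> dist (a n) L < e}"
    by (simp add: frequently_cofinite[symmetric] cofinite_eq_sequentially not_eventually)
  then obtain s :: "nat \<Rightarrow> nat" where s: "strict_mono s" "\<And>n. s n \<in> {n. \<not> dist (a n) L < e}"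
    using infinite_enumerate by blast
  have "bounded (range (a \<circ> s))"
    using bd by (rule bounded_subset) auto
  then obtain l r where r: "strict_mono r" "(a \<circ> s \<circ> r) \<longlonglongrightarrow> l"
    using bounded_imp_convergent_subsequence by blast
  then have "l = L"
    using eq[of "s \<circ> r" l] s(1) by (simp add: strict_mono_o o_assoc)
  with r(2) have "\<forall>\<^sub>F n in sequentially. dist ((a \<circ> s \<circ> r) n) L < e"
    using e(1) by (auto simp: tendsto_iff)
  then show False
    using s(2) by (auto simp: eventually_sequentially)
qed

lemma tendsto_integral_inner_uniform:
  fixes f :: "nat \<Rightarrow> real \<Rightarrow> 'a::euclidean_space"
  assumes u: "uniform_limit {0..1} f g sequentially" and f: "\<And>k. continuous_on {0..1} (f k)" and w: "continuous_on {0..1} w"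
  shows "(\<lambda>k. integral {0..1} (\<lambda>t. f k t \<bullet> w t)) \<longlonglongrightarrow> integral {0..1} (\<lambda>t. g t \<bullet> w t)"
proof -
  have "bounded (w ` {0..1})"
    by (intro compact_imp_bounded compact_continuous_image w) simp
  then obtain K where K: "0 < K" "\<And>t. t \<in> {0..1} \<Longrightarrow> norm (w t) \<le> K"
    unfolding bounded_pos by auto
  have "uniform_limit {0..1} (\<lambda>k t. f k t \<bullet> w t) (\<lambda>t. g t \<bullet> w t) sequentially"
  proof (rule uniform_limitI)
    fix e :: real assume "0 < e"
    then have "\<forall>\<^sub>F k in sequentially. \<forall>t\<in>{0..1}. dist (f k t) (g t) < e / K"
      using K(1) by (intro uniform_limitD[OF u]) simp
    then show "\<forall>\<^sub>F k in sequentially. \<forall>t\<in>{0..1}. dist (f k t \<bullet> w t) (g t \<bullet> w t) < e"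
    proof eventually_elim
      case (elim k)
      show ?case
      proof
        fix t :: real assume t: "t \<in> {0..1}"
        have "dist (f k t \<bullet> w t) (g t \<bullet> w t) = \<bar>(f k t - g t) \<bullet> w t\<bar>"
          by (simp add: dist_real_def inner_diff_left)
        also have "\<dots> \<le> norm (f k t - g t) * norm (w t)" by (rule Cauchy_Schwarz_ineq2)
        also have "\<dots> \<le> norm (f k t - g t) * K" using K(2)[OF t] by (intro mult_left_mono) auto
        also have "\<dots> < e"
          using elim t K(1) by (simp add: dist_norm pos_less_divide_eq)
        finally show "dist (f k t \<bullet> w t) (g t \<bullet> w t) < e" .
      qed
    qed
  qed
  moreover have "continuous_on {0..1} (\<lambda>t. f k t \<bullet> w t)" for k
    by (intro continuous_intros f w)
  ultimately obtain I J where "\<And>k. ((\<lambda>t. f k t \<bullet> w t) has_integral I k) {0..1}"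
    "((\<lambda>t. g t \<bullet> w t) has_integral J) {0..1}" "I \<longlonglongrightarrow> J"
    by (rule uniform_limit_integral) auto
  then show ?thesis by (metis (no_types, lifting) ext integral_unique)
qed

text \<open>Uniform convergence of the velocities makes the errors in all increment constraints
  small at once, whatever x and y; this is the uniformity that \<open>L2_weak_limit_exists\<close>
  asks for. The slot \<psi> carries one further pairing and is filled with 0 when none is wanted.
  Since the bound is eventual and up to \<epsilon>, C may be a limiting value.\<close>

lemma d2_weak_limit_exists:
  assumes W: "\<And>k. W22 (f k)" and u: "uniform_limit {0..1} (\<lambda>k. d1 (f k)) v sequentially"
    and bound: "\<And>\<epsilon>. 0 < \<epsilon> \<Longrightarrow> \<forall>\<^sub>F k in sequentially. L2_sq (lebesgue_on {0..1}) (d2 (f k)) \<le> C + \<epsilon>"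
    and \<psi>: "L2 (lebesgue_on {0..1}) \<psi>"
    and lim: "(\<lambda>k. \<integral>t. d2 (f k) t \<bullet> \<psi> t \<partial>lebesgue_on {0..1}) \<longlonglongrightarrow> l"
  obtains g where "L2 (lebesgue_on {0..1}) g" "L2_sq (lebesgue_on {0..1}) g \<le> C"
    "(\<integral>t. g t \<bullet> \<psi> t \<partial>lebesgue_on {0..1}) = l"
    "\<And>x y. 0 \<le> x \<Longrightarrow> x \<le> y \<Longrightarrow> y \<le> 1 \<Longrightarrow> (g has_integral v y - v x) {x..y}"
proof -
  let ?M = "lebesgue_on {0..1::real}"
  interpret finite_measure ?M
    by (rule finite_measure_lebesgue_on) simp
  define J where "J = insert (\<psi>, l) {(\<lambda>t. indicator {x..y} t *\<^sub>R i, (v y - v x) \<bullet> i) |x y i. 0 \<le> x \<and> x \<le> y \<and> y \<le> 1 \<and> i \<in> Basis}"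
  have JL2: "L2 ?M \<phi>" if "(\<phi>, c) \<in> J" for \<phi> c
    using that \<psi> L2_indicator by (auto simp: J_def)
  have conv: "\<forall>\<^sub>F k in sequentially. \<forall>(\<phi>, c)\<in>J. \<bar>(\<integral>t. d2 (f k) t \<bullet> \<phi> t \<partial>?M) - c\<bar> \<le> \<epsilon>" if "0 < \<epsilon>" for \<epsilon>
  proof -
    have "\<forall>\<^sub>F k in sequentially. \<forall>t\<in>{0..1}. dist (d1 (f k) t) (v t) < \<epsilon> / 2"
      using that by (intro uniform_limitD[OF u]) simp
    moreover have "\<forall>\<^sub>F k in sequentially. dist (\<integral>t. d2 (f k) t \<bullet> \<psi> t \<partial>?M) l < \<epsilon>"
      using lim that by (rule tendstoD)
    ultimately show ?thesis
    proof eventually_elim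
      case (elim k)
      have "\<bar>(\<integral>t. d2 (f k) t \<bullet> (indicator {x..y} t *\<^sub>R i) \<partial>?M) - (v y - v x) \<bullet> i\<bar> \<le> \<epsilon>"
        if xy: "0 \<le> x" "x \<le> y" "y \<le> 1" and i: "i \<in> Basis" for x y i
      proof -
        have "integral {x..y} (d2 (f k)) = d1 (f k) y - d1 (f k) x"
          by (rule integral_unique[OF W22_d2_integral(1)[OF W xy(2)]])
        then have "(\<integral>t. d2 (f k) t \<bullet> (indicator {x..y} t *\<^sub>R i) \<partial>?M) - (v y - v x) \<bullet> i
            = ((d1 (f k) y - v y) - (d1 (f k) x - v x)) \<bullet> i"
          unfolding L2_integral_indicator(2)[OF W22_L2_d2[OF W] xy(1,3)] by (simp add: inner_diff_left)
        also have "\<bar>\<dots>\<bar> \<le> norm ((d1 (f k) y - v y) - (d1 (f k) x - v x))"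
          using Basis_le_norm[OF i] by blast
        also have "\<dots> \<le> norm (d1 (f k) y - v y) + norm (d1 (f k) x - v x)"
          by (rule norm_triangle_ineq4)
        also have "\<dots> \<le> \<epsilon>"
          using bspec[OF elim(1), of x] bspec[OF elim(1), of y] xy by (simp add: dist_norm)
        finally show ?thesis .
      qed
      then show ?case
        using elim(2) by (auto simp: J_def dist_real_def)
    qed
  qed
  obtain g where g: "L2 ?M g" "L2_sq ?M g \<le> C" "\<And>\<phi> c. (\<phi>, c) \<in> J \<Longrightarrow> (\<integral>t. g t \<bullet> \<phi> t \<partial>?M) = c"
    by (rule L2_weak_limit_exists[of "\<lambda>k. d2 (f k)" C J, OF W22_L2_d2[OF W]], erule bound, erule JL2, erule conv)
       (rule that)
  have "(g has_integral v y - v x) {x..y}" if xy: "0 \<le> x" "x \<le> y" "y \<le> 1" for x y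
  proof -
    have "integral {x..y} g \<bullet> i = (v y - v x) \<bullet> i" if "i \<in> Basis" for i
      using g(3)[of "\<lambda>t. indicator {x..y} t *\<^sub>R i" "(v y - v x) \<bullet> i"] L2_integral_indicator(2)[OF g(1) xy(1,3), of i] xy that
      by (auto simp: J_def)
    then have "integral {x..y} g = v y - v x" by (rule euclidean_eqI)
    then show ?thesis
      using L2_integral_indicator(1)[OF g(1) xy(1,3)] by (metis integrable_integral)
  qed
  moreover have "(\<integral>t. g t \<bullet> \<psi> t \<partial>?M) = l" using g(3) by (simp add: J_def)
  ultimately show ?thesis using that g by blast
qed

text \<open>Both functions are densities of the same velocity and hence agree almost everywhere;
  norms and pairings found for a constructed density thus transfer to \<open>d2\<close>.\<close>

lemma density_of_d1_eq_d2:
  assumes W: "W22 \<gamma>" and g: "L2 (lebesgue_on {0..1}) g"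
    and int: "\<And>x y. 0 \<le> x \<Longrightarrow> x \<le> y \<Longrightarrow> y \<le> 1 \<Longrightarrow> (g has_integral d1 \<gamma> y - d1 \<gamma> x) {x..y}"
  shows "L2_sq (lebesgue_on {0..1}) (d2 \<gamma>) = L2_sq (lebesgue_on {0..1}) g"
    and "L2 (lebesgue_on {0..1}) \<psi> \<Longrightarrow>
      (\<integral>t. d2 \<gamma> t \<bullet> \<psi> t \<partial>lebesgue_on {0..1}) = (\<integral>t. g t \<bullet> \<psi> t \<partial>lebesgue_on {0..1})"
proof -
  obtain N where N: "negligible N" "\<And>x. x \<in> {0..1} - N \<Longrightarrow> d2 \<gamma> x = g x"
    by (rule d2_AE_eq_density[OF _ zero_less_one], erule (2) int) (rule that)
  show "L2_sq (lebesgue_on {0..1}) (d2 \<gamma>) = L2_sq (lebesgue_on {0..1}) g"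
    unfolding L2_lebesgue_on_sq(2)[OF g] L2_lebesgue_on_sq(2)[OF W22_L2_d2[OF W]]
    by (rule integral_spike[OF N(1)]) (simp add: N(2))
  show "(\<integral>t. d2 \<gamma> t \<bullet> \<psi> t \<partial>lebesgue_on {0..1}) = (\<integral>t. g t \<bullet> \<psi> t \<partial>lebesgue_on {0..1})"
    if "L2 (lebesgue_on {0..1}) \<psi>"
    unfolding L2_inner_integral(2)[OF g that] L2_inner_integral(2)[OF W22_L2_d2[OF W] that]
    by (rule integral_spike[OF N(1)]) (simp add: N(2))
qed

text \<open>Separates the two terms that follow from uniform convergence from the one that needs a
  weak argument.\<close>

lemma W22_inner_eq:
  assumes "W22 u" "W22 w"
  shows "W22_inner u w = integral {0..1} (\<lambda>t. u t \<bullet> w t) + integral {0..1} (\<lambda>t. d1 u t \<bullet> d1 w t)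
    + (\<integral>t. d2 u t \<bullet> d2 w t \<partial>lebesgue_on {0..1})"
proof -
  have i1: "(\<lambda>t. u t \<bullet> w t) integrable_on {0..1}" and i2: "(\<lambda>t. d1 u t \<bullet> d1 w t) integrable_on {0..1}"
    by (intro integrable_continuous_interval continuous_intros W22_continuous W22_continuous_d1 assms)+
  note i3 = L2_inner_integral[OF W22_L2_d2[OF assms(1)] W22_L2_d2[OF assms(2)]]
  show ?thesis
    unfolding W22_inner_def i3(2)
    by (simp add: integral_add integrable_add i1 i2 i3(1))
qed

section \<open>Limits of symmetric unit-speed curves\<close>

lemma tendsto_R:
  assumes "(X \<longlongrightarrow> L) F"
  shows "((\<lambda>n. R1 (X n)) \<longlongrightarrow> R1 L) F" "((\<lambda>n. R2 (X n)) \<longlongrightarrow> R2 L) F" "((\<lambda>n. R3 (X n)) \<longlongrightarrow> R3 L) F"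
proof -
  have c: "((\<lambda>n. X n $ i) \<longlongrightarrow> L $ i) F" for i by (rule tendsto_vec_nth[OF assms])
  have "((\<lambda>n. vector [f n, g n, h n] :: real^3) \<longlongrightarrow> vector [a, b, c]) F"
    if "(f \<longlongrightarrow> a) F" "(g \<longlongrightarrow> b) F" "(h \<longlongrightarrow> c) F" for f g h a b c
  proof (rule vec_tendstoI)
    fix i :: 3
    show "((\<lambda>n. (vector [f n, g n, h n] :: real^3) $ i) \<longlongrightarrow> (vector [a, b, c] :: real^3) $ i) F"
      using exhaust_3[of i] that by (auto simp: vector_3)
  qed
  then show "((\<lambda>n. R1 (X n)) \<longlongrightarrow> R1 L) F" "((\<lambda>n. R2 (X n)) \<longlongrightarrow> R2 L) F" "((\<lambda>n. R3 (X n)) \<longlongrightarrow> R3 L) F"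
    unfolding R1_def R2_def R3_def by (simp_all add: c tendsto_minus)
qed

lemma arclength_Lipschitz:
  assumes W: "W22 \<gamma>" and a: "arclength \<gamma>"
  shows "norm (\<gamma> y - \<gamma> x) \<le> \<bar>y - x\<bar>"
proof -
  have *: "norm (\<gamma> y - \<gamma> x) \<le> y - x" if "x \<le> y" for x y
  proof -
    have "(d1 \<gamma> has_integral \<gamma> y - \<gamma> x) {x..y}"
      by (rule fundamental_theorem_of_calculus[OF that]) (rule has_vector_derivative_at_within[OF W22_d1[OF W]])
    then have "norm (\<gamma> y - \<gamma> x) \<le> 1 * measure lborel {x..y}"
      using a by (intro has_integral_bound_real[of 1 "{}" "d1 \<gamma>"]) (auto simp: arclength_def)
    then show ?thesis using that by simp
  qed
  show ?thesis
    using *[of x y] *[of y x] by (cases "x \<le> y") (auto simp: norm_minus_commute)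
qed

text \<open>\<open>R3\<close> puts \<open>\<gamma> 0\<close> on the third coordinate axis and \<open>R1\<close> maps \<open>\<gamma> (1/2)\<close> to \<open>\<gamma> 0\<close>, so the two
  points are antipodal and their distance bounds both norms.\<close>

lemma D2_symmetric_norm_le:
  assumes W: "W22 \<gamma>" and a: "arclength \<gamma>" and D: "D2_symmetric \<gamma>" and t: "t \<in> {0..1}"
  shows "norm (\<gamma> t) \<le> 2"
proof -
  have "R3 (\<gamma> (- 0)) = \<gamma> 0" "R1 (\<gamma> (- 0 + 1/2)) = \<gamma> 0"
    using D unfolding D2_symmetric_def by blast+
  then have "\<gamma> 0 $ 1 = - (\<gamma> 0 $ 1)" "\<gamma> 0 $ 2 = - (\<gamma> 0 $ 2)" "\<gamma> 0 $ 3 = - (\<gamma> (1/2) $ 3)"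
    unfolding R1_def R3_def by (metis vector_3 minus_zero add_0)+
  then have c: "\<gamma> 0 $ 1 = 0" "\<gamma> 0 $ 2 = 0" "\<gamma> (1/2) $ 3 = - (\<gamma> 0 $ 3)" by simp_all
  have "\<bar>(\<gamma> 0 - \<gamma> (1/2)) $ 3\<bar> \<le> norm (\<gamma> 0 - \<gamma> (1/2))" by (rule component_le_norm_cart)
  also have "\<dots> \<le> 1/2" using arclength_Lipschitz[OF W a, of 0 "1/2"] by simp
  finally have "\<bar>\<gamma> 0 $ 3\<bar> \<le> 1/4" using c by simp
  then have "norm (\<gamma> 0) \<le> 1"
    using norm_le_l1_cart[of "\<gamma> 0"] c by (simp add: sum_3)
  moreover have "norm (\<gamma> t - \<gamma> 0) \<le> 1" using arclength_Lipschitz[OF W a, of t 0] t by simp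
  ultimately show ?thesis
    using norm_triangle_ineq[of "\<gamma> 0" "\<gamma> t - \<gamma> 0"] by simp
qed

lemma C1_limit:
  fixes f :: "nat \<Rightarrow> curve"
  assumes d: "\<And>k t. (f k has_vector_derivative f' k t) (at t)"
    and u: "uniform_limit UNIV f g sequentially" and u': "uniform_limit UNIV f' g' sequentially"
  shows "(g has_vector_derivative g' t) (at t)"
proof -
  have "\<exists>G. \<forall>x\<in>UNIV. (\<lambda>n. f n x) \<longlonglongrightarrow> G x \<and> (G has_derivative (\<lambda>h. h *\<^sub>R g' x)) (at x within UNIV)"
  proof (rule has_derivative_sequence[where f' = "\<lambda>n x h. h *\<^sub>R f' n x"])
    show "(f n has_derivative (\<lambda>h. h *\<^sub>R f' n x)) (at x within UNIV)" for n x
      using d[of n x] by (simp add: has_vector_derivative_def)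
    show "\<forall>\<^sub>F n in sequentially. \<forall>x\<in>UNIV. \<forall>h. norm (h *\<^sub>R f' n x - h *\<^sub>R g' x) \<le> e * norm h" if "0 < e" for e
      using uniform_limitD[OF u' that]
    proof eventually_elim
      case (elim n)
      show ?case
      proof (intro ballI allI)
        fix x h :: real
        have "norm (h *\<^sub>R f' n x - h *\<^sub>R g' x) = norm (f' n x - g' x) * norm h"
          by (simp add: scaleR_diff_right[symmetric])
        also have "\<dots> \<le> e * norm h"
          using elim by (intro mult_right_mono) (auto simp: dist_norm less_imp_le)
        finally show "norm (h *\<^sub>R f' n x - h *\<^sub>R g' x) \<le> e * norm h" .
      qed
    qed
    show "(\<lambda>n. f n t) \<longlonglongrightarrow> g t" by (rule tendsto_uniform_limitI[OF u]) simp
  qed auto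
  then obtain G where G: "\<And>x. (\<lambda>n. f n x) \<longlonglongrightarrow> G x" "\<And>x. (G has_derivative (\<lambda>h. h *\<^sub>R g' x)) (at x)"
    by auto
  have "G = g"
    using LIMSEQ_unique[OF G(1) tendsto_uniform_limitI[OF u]] by (auto simp: fun_eq_iff)
  then show ?thesis using G(2)[of t] by (simp add: has_vector_derivative_def)
qed

text \<open>Position and velocity are treated as a single map into the product space, so that one
  subsequence serves both and the limit of the velocities is the derivative of the limit by
  \<open>C1_limit\<close>.\<close>

lemma symmetric_arclength_compactness:
  fixes f :: "nat \<Rightarrow> curve"
  assumes W: "\<And>k. W22 (f k)" and a: "\<And>k. arclength (f k)" and D: "\<And>k. D2_symmetric (f k)"
    and C: "\<And>k. L2_sq (lebesgue_on {0..1}) (d2 (f k)) \<le> C"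
  obtains g r where "strict_mono r" "W22 g" "arclength g" "D2_symmetric g" "C1_conv (\<lambda>k. f (r k)) g"
proof -
  let ?M = "lebesgue_on {0..1::real}"
  have n1: "norm (d1 (f k) t) = 1" for k t using a by (simp add: arclength_def)
  \<comment> \<open>Common modulus of continuity: r for the 1-Lipschitz positions, the square root
    term for the velocities.\<close>
  define \<phi> where "\<phi> r = r + sqrt r * sqrt C" for r
  have mod_le: "norm ((f k x, d1 (f k) x) - (f k y, d1 (f k) y)) \<le> \<phi> \<bar>x - y\<bar>"
    if xy: "x \<in> {0..1}" "y \<in> {0..1}" for k x y
  proof -
    have d: "norm (d1 (f k) y - d1 (f k) x) \<le> sqrt (y - x) * sqrt C" if "0 \<le> x" "x \<le> y" "y \<le> 1" for x y
    proof -
      have "norm (integral {x..y} (d2 (f k))) \<le> sqrt (y - x) * sqrt (L2_sq ?M (d2 (f k)))"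
        by (rule norm_integral_le_sqrt[OF W22_L2_d2[OF W] that])
      also have "\<dots> \<le> sqrt (y - x) * sqrt C"
        using C that by (intro mult_left_mono) auto
      finally show ?thesis
        using integral_unique[OF W22_d2_integral(1)[OF W that(2)], of k] by simp
    qed
    have "norm (d1 (f k) x - d1 (f k) y) \<le> sqrt \<bar>x - y\<bar> * sqrt C"
      using d[of x y] d[of y x] xy by (cases "x \<le> y") (auto simp: norm_minus_commute)
    moreover have "norm (f k x - f k y) \<le> \<bar>x - y\<bar>"
      by (rule arclength_Lipschitz[OF W a])
    ultimately show ?thesis
      using norm_Pair_le[of "f k x - f k y" "d1 (f k) x - d1 (f k) y"] by (simp add: \<phi>_def)
  qed
  obtain G r where r: "strict_mono (r :: nat \<Rightarrow> nat)" and
    G: "\<And>e. 0 < e \<Longrightarrow> \<exists>N. \<forall>n x. n \<ge> N \<and> x \<in> {0..1::real} \<longrightarrow> norm ((f (r n) x, d1 (f (r n)) x) - G x) < e"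
  proof (rule Arzela_Ascoli[of "{0..1::real}" "\<lambda>k x. (f k x, d1 (f k) x)" 3])
    \<comment> \<open>The 3 is the position bound 2 from the symmetry plus the speed 1.\<close>
    show "norm (f k x, d1 (f k) x) \<le> 3" if "x \<in> {0..1}" for k x
      using norm_Pair_le[of "f k x" "d1 (f k) x"] D2_symmetric_norm_le[OF W a D that, of k] n1[of k x] by simp
    show "\<exists>d>0. \<forall>n y. y \<in> {0..1} \<and> norm (x - y) < d \<longrightarrow> norm ((f n x, d1 (f n) x) - (f n y, d1 (f n) y)) < e"
      if x: "x \<in> {0..1}" and e: "0 < e" for x e
    proof -
      have "isCont \<phi> 0" unfolding \<phi>_def by (intro continuous_intros)
      then obtain d where d: "0 < d" "\<And>r. \<bar>r\<bar> < d \<Longrightarrow> \<bar>\<phi> r\<bar> < e"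
        using e unfolding continuous_at_eps_delta by (auto simp: \<phi>_def)
      show ?thesis
      proof (intro exI[of _ d] conjI allI impI d(1))
        fix n y assume y: "y \<in> {0..1} \<and> norm (x - y) < d"
        have "norm ((f n x, d1 (f n) x) - (f n y, d1 (f n) y)) \<le> \<phi> \<bar>x - y\<bar>"
          using x y by (intro mod_le) auto
        also have "\<dots> < e" using d(2)[of "\<bar>x - y\<bar>"] y by auto
        finally show "norm ((f n x, d1 (f n) x) - (f n y, d1 (f n) y)) < e" .
      qed
    qed
  qed (auto intro: that)
  \<comment> \<open>The limit is known on [0,1] only. Composing with \<open>frac\<close> makes it
    periodic, and periodicity of the approximating curves makes the convergence uniform on the whole
    line.\<close>
  define g where "g t = fst (G (frac t))" for t
  define v where "v t = snd (G (frac t))" for t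
  have fr: "f k (frac t) = f k t" "d1 (f k) (frac t) = d1 (f k) t" for k t
    using periodic_shift_int[of "f k" "frac t" "\<lfloor>t\<rfloor>"] periodic_shift_int[of "d1 (f k)" "frac t" "\<lfloor>t\<rfloor>"]
      W22_periodic[OF W, of k] d1_periodic[of "f k"] by (simp_all add: frac_def)
  have frac01: "frac t \<in> {0..1}" for t :: real
    using frac_lt_1[of t] by (auto intro: less_imp_le)
  have unif: "\<forall>\<^sub>F n in sequentially. \<forall>t. dist (f (r n) t) (g t) < e \<and> dist (d1 (f (r n)) t) (v t) < e" if "0 < e" for e
  proof -
    obtain N where N: "\<And>n x. n \<ge> N \<Longrightarrow> x \<in> {0..1} \<Longrightarrow> norm ((f (r n) x, d1 (f (r n)) x) - G x) < e"
      using G[OF \<open>0 < e\<close>] by blast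
    show ?thesis
    proof (rule eventually_sequentiallyI[of N], intro allI)
      fix n t assume "N \<le> n"
      then have "norm ((f (r n) (frac t), d1 (f (r n)) (frac t)) - G (frac t)) < e"
        by (rule N[OF _ frac01])
      then have "norm (f (r n) t - g t, d1 (f (r n)) t - v t) < e"
        by (cases "G (frac t)") (simp add: g_def v_def fr)
      then show "dist (f (r n) t) (g t) < e \<and> dist (d1 (f (r n)) t) (v t) < e"
        using norm_fst_le[of "f (r n) t - g t" "d1 (f (r n)) t - v t"]
          norm_snd_le[of "d1 (f (r n)) t - v t" "f (r n) t - g t"] by (simp add: dist_norm)
    qed
  qed
  have u: "uniform_limit UNIV (\<lambda>n. f (r n)) g sequentially"
  proof (rule uniform_limitI)
    show "\<forall>\<^sub>F n in sequentially. \<forall>t\<in>UNIV. dist (f (r n) t) (g t) < e" if "0 < e" for e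
      using unif[OF that] by eventually_elim simp
  qed
  have u': "uniform_limit UNIV (\<lambda>n. d1 (f (r n))) v sequentially"
  proof (rule uniform_limitI)
    show "\<forall>\<^sub>F n in sequentially. \<forall>t\<in>UNIV. dist (d1 (f (r n)) t) (v t) < e" if "0 < e" for e
      using unif[OF that] by eventually_elim simp
  qed
  have gd: "(g has_vector_derivative v t) (at t)" for t
    by (rule C1_limit[OF W22_d1[OF W] u u'])
  then have d1g: "d1 g = v"
    by (auto simp: d1_def fun_eq_iff vector_derivative_at)
  have lim: "(\<lambda>n. f (r n) t) \<longlonglongrightarrow> g t" "(\<lambda>n. d1 (f (r n)) t) \<longlonglongrightarrow> v t" for t
    by (rule tendsto_uniform_limitI[OF u], simp) (rule tendsto_uniform_limitI[OF u'], simp)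
  have "arclength g"
    unfolding arclength_def d1g
  proof
    fix t
    have "(\<lambda>n. norm (d1 (f (r n)) t)) \<longlonglongrightarrow> norm (v t)" by (intro tendsto_norm lim)
    then show "norm (v t) = 1" by (simp add: n1 LIMSEQ_const_iff)
  qed
  moreover have "D2_symmetric g"
    unfolding D2_symmetric_def
  proof (intro conjI allI)
    fix t
    have "R1 (f k (- t + 1/2)) = f k t" "R2 (f k (t - 1/2)) = f k t" "R3 (f k (- t)) = f k t" for k
      using D[of k] unfolding D2_symmetric_def by blast+
    then have "(\<lambda>n. R1 (f (r n) (- t + 1/2))) \<longlonglongrightarrow> g t" "(\<lambda>n. R2 (f (r n) (t - 1/2))) \<longlonglongrightarrow> g t"
      "(\<lambda>n. R3 (f (r n) (- t))) \<longlonglongrightarrow> g t"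
      using lim(1)[of t] by (simp_all only:)
    then show "R1 (g (- t + 1/2)) = g t" "R2 (g (t - 1/2)) = g t" "R3 (g (- t)) = g t"
      using tendsto_R[OF lim(1)] LIMSEQ_unique by blast+
  qed
  moreover have "W22 g"
  proof -
    have u01: "uniform_limit {0..1} (\<lambda>k. d1 (f (r k))) v sequentially"
      using u' by (rule uniform_limit_on_subset) simp
    have bound: "\<forall>\<^sub>F k in sequentially. L2_sq ?M (d2 (f (r k))) \<le> C + \<epsilon>" if "0 < \<epsilon>" for \<epsilon>
      using C that by (intro always_eventually allI) (simp add: add_increasing2)
    \<comment> \<open>No further pairing is prescribed here: only a square-integrable density of v
      is wanted.\<close>
    have zero: "L2 ?M (\<lambda>t. 0 :: real^3)" by (simp add: L2_def)
    have lim0: "(\<lambda>k. \<integral>t. d2 (f (r k)) t \<bullet> 0 \<partial>?M) \<longlonglongrightarrow> 0" by simp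
    obtain h where h: "L2 ?M h"
      "\<And>x y. 0 \<le> x \<Longrightarrow> x \<le> y \<Longrightarrow> y \<le> 1 \<Longrightarrow> (h has_integral v y - v x) {x..y}"
      by (rule d2_weak_limit_exists[OF W u01 _ zero lim0], erule bound) (rule that)
    show ?thesis
    proof (rule W22_intro)
      show "g (t + 1) = g t" for t by (simp add: g_def frac_1_eq)
      show "g differentiable (at t)" for t using gd[of t] by (rule differentiableI_vector)
      show "(h has_integral d1 g y - d1 g x) {x..y}" if "0 \<le> x" "x \<le> y" "y \<le> 1" for x y
        unfolding d1g by (rule h(2)[OF that])
      show "(\<lambda>t. (norm (h t))\<^sup>2) integrable_on {0..1}" by (rule L2_lebesgue_on_sq(1)[OF h(1)])
    qed
  qed
  moreover have "C1_conv (\<lambda>k. f (r k)) g"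
    unfolding C1_conv_def d1g using u u' by simp
  ultimately show ?thesis using that r by blast
qed

text \<open>Adding the test function to the constraints identifies the limit of every convergent
  subsequence of the pairings, which avoids a density argument.\<close>

lemma W22_weak_conv_of_C1_conv:
  assumes W: "\<And>k. W22 (f k)" and Wg: "W22 g" and C1: "C1_conv f g"
    and C: "\<And>k. L2_sq (lebesgue_on {0..1}) (d2 (f k)) \<le> C"
  shows "W22_weak_conv f g"
  unfolding W22_weak_conv_def
proof (intro allI impI)
  let ?M = "lebesgue_on {0..1::real}"
  fix w assume w: "W22 w"
  have u: "uniform_limit {0..1} f g sequentially" "uniform_limit {0..1} (\<lambda>k. d1 (f k)) (d1 g) sequentially"
    using C1 unfolding C1_conv_def by (auto elim: uniform_limit_on_subset)
  have wL2: "L2 ?M (d2 w)" by (rule W22_L2_d2[OF w])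
  define a where "a k = (\<integral>t. d2 (f k) t \<bullet> d2 w t \<partial>?M)" for k
  have "a \<longlonglongrightarrow> (\<integral>t. d2 g t \<bullet> d2 w t \<partial>?M)"
  proof (rule tendsto_if_subseq_limits_eq)
    have "norm (a k) \<le> sqrt C * sqrt (L2_sq ?M (d2 w))" for k
    proof -
      have "norm (a k) \<le> sqrt (L2_sq ?M (d2 (f k))) * sqrt (L2_sq ?M (d2 w))"
        unfolding a_def real_norm_def by (rule L2_Cauchy_Schwarz[OF W22_L2_d2[OF W] wL2])
      also have "\<dots> \<le> sqrt C * sqrt (L2_sq ?M (d2 w))"
        using C by (intro mult_right_mono) (auto simp: L2_sq_nonneg)
      finally show ?thesis .
    qed
    then show "bounded (range a)" unfolding bounded_iff by blast
  next
    fix s l assume s: "strict_mono s" "(a \<circ> s) \<longlonglongrightarrow> l"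
    have us: "uniform_limit {0..1} (\<lambda>k. d1 (f (s k))) (d1 g) sequentially"
      using filterlim_compose[OF u(2) filterlim_subseq[OF s(1)]] by simp
    have bound: "\<forall>\<^sub>F k in sequentially. L2_sq ?M (d2 (f (s k))) \<le> C + \<epsilon>" if "0 < \<epsilon>" for \<epsilon>
      using C that by (intro always_eventually allI) (simp add: add_increasing2)
    have lim: "(\<lambda>k. \<integral>t. d2 (f (s k)) t \<bullet> d2 w t \<partial>?M) \<longlonglongrightarrow> l"
      using s(2) by (simp add: a_def o_def)
    \<comment> \<open>The function h may depend on the subsequence, but as a density of
      \<open>d1 g\<close> it equals \<open>d2 g\<close> almost everywhere, so l does not.\<close>
    obtain h where h: "L2 ?M h" "(\<integral>t. h t \<bullet> d2 w t \<partial>?M) = l"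
      "\<And>x y. 0 \<le> x \<Longrightarrow> x \<le> y \<Longrightarrow> y \<le> 1 \<Longrightarrow> (h has_integral d1 g y - d1 g x) {x..y}"
      by (rule d2_weak_limit_exists[OF W us _ wL2 lim], erule bound) (rule that)
    have "(\<integral>t. d2 g t \<bullet> d2 w t \<partial>?M) = (\<integral>t. h t \<bullet> d2 w t \<partial>?M)"
      by (rule density_of_d1_eq_d2(2)[OF Wg h(1) _ wL2]) (rule h(3))
    then show "l = (\<integral>t. d2 g t \<bullet> d2 w t \<partial>?M)" using h(2) by simp
  qed
  then show "(\<lambda>k. W22_inner (f k) w) \<longlonglongrightarrow> W22_inner g w"
    unfolding W22_inner_eq[OF W w] W22_inner_eq[OF Wg w] a_def
    by (intro tendsto_add tendsto_integral_inner_uniform u W22_continuous[OF W] W22_continuous_d1[OF W]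
        W22_continuous[OF w] W22_continuous_d1[OF w])
qed

theorem theorem1p3:
  fixes q :: real and p :: curve and \<theta> :: "nat \<Rightarrow> real" and \<Gamma> :: "nat \<Rightarrow> curve"
  assumes "2 < q" "q \<le> 4"
    and "embedded_polygon p"
    and "\<exists>\<beta>\<in>CK p. D2_symmetric \<beta>"
    and "\<And>j. 0 < \<theta> j" and "\<theta> \<longlonglongrightarrow> 0"
    and "\<And>j. \<Gamma> j \<in> CK p \<and> arclength (\<Gamma> j) \<and> D2_symmetric (\<Gamma> j)"
    and "\<And>j \<beta>. \<beta> \<in> CK p \<Longrightarrow> D2_symmetric \<beta> \<Longrightarrow> E_theta q (\<theta> j) (\<Gamma> j) \<le> E_theta q (\<theta> j) \<beta>"
  shows "\<exists>\<Gamma>0 r. W22 \<Gamma>0 \<and> arclength \<Gamma>0 \<and> D2_symmetric \<Gamma>0 \<and> strict_mono r \<and>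
           W22_weak_conv (\<lambda>k. \<Gamma> (r k)) \<Gamma>0 \<and> C1_conv (\<lambda>k. \<Gamma> (r k)) \<Gamma>0 \<and>
           (\<forall>\<beta>\<in>CK p. D2_symmetric \<beta> \<longrightarrow> bending \<Gamma>0 \<le> bending \<beta>)"
proof -
  let ?M = "lebesgue_on {0..1::real}"
  have W: "W22 (\<Gamma> j)" and a: "arclength (\<Gamma> j)" and D: "D2_symmetric (\<Gamma> j)" for j
    using assms(7)[of j] by (auto simp: CK_def)
  \<comment> \<open>T depends on the competitor but not on j, so the error vanishes with
    \<open>\<theta> j\<close>.\<close>
  have upper: "\<exists>T\<ge>0. \<forall>j. L2_sq ?M (d2 (\<Gamma> j)) \<le> bending \<beta> + \<theta> j * T" if \<beta>: "\<beta> \<in> CK p" "D2_symmetric \<beta>" for \<beta>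
  proof -
    have "tp_energy q \<beta> < \<infinity>"
      using \<beta>(1) assms(1,2) by (intro tp_energy_finite) (auto simp: CK_def)
    then show ?thesis
      using bending_le_of_E_theta_le[OF assms(8)[OF \<beta>] _ assms(5)] bending_arclength[OF W a]
      by (metis powr_ge_zero)
  qed
  \<comment> \<open>One fixed competitor suffices for the uniform bound behind compactness;
    minimality is tested against every competitor only after the limit has been chosen.\<close>
  obtain \<beta>\<^sub>0 where "\<beta>\<^sub>0 \<in> CK p" "D2_symmetric \<beta>\<^sub>0" using assms(4) by blast
  then obtain T\<^sub>0 where T\<^sub>0: "0 \<le> T\<^sub>0" "\<And>j. L2_sq ?M (d2 (\<Gamma> j)) \<le> bending \<beta>\<^sub>0 + \<theta> j * T\<^sub>0"
    using upper by blast
  obtain K where K: "\<And>j. \<bar>\<theta> j\<bar> \<le> K"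
    using convergent_imp_Bseq[of \<theta>] assms(6) unfolding Bseq_def convergent_def by auto
  define C where "C = bending \<beta>\<^sub>0 + K * T\<^sub>0"
  have C: "L2_sq ?M (d2 (\<Gamma> j)) \<le> C" for j
    using T\<^sub>0(2)[of j] mult_right_mono[OF abs_le_D1[OF K[of j]] T\<^sub>0(1)] by (simp add: C_def)
  obtain \<Gamma>0 r where lim: "strict_mono r" "W22 \<Gamma>0" "arclength \<Gamma>0" "D2_symmetric \<Gamma>0" "C1_conv (\<lambda>k. \<Gamma> (r k)) \<Gamma>0"
    by (rule symmetric_arclength_compactness[OF W a D C])
  have weak: "W22_weak_conv (\<lambda>k. \<Gamma> (r k)) \<Gamma>0"
    by (rule W22_weak_conv_of_C1_conv[OF W lim(2,5) C])
  \<comment> \<open>Lower semicontinuity is applied anew for each competitor with C =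
    \<open>bending \<beta>\<close>, a bound that the energies along the subsequence respect only up
    to arbitrarily small errors. The density h may vary with \<beta>, but its norm is that of
    \<open>d2 \<Gamma>0\<close>.\<close>
  have min: "bending \<Gamma>0 \<le> bending \<beta>" if \<beta>: "\<beta> \<in> CK p" "D2_symmetric \<beta>" for \<beta>
  proof -
    obtain T where T: "0 \<le> T" "\<And>j. L2_sq ?M (d2 (\<Gamma> j)) \<le> bending \<beta> + \<theta> j * T"
      using upper[OF \<beta>] by blast
    have \<theta>T: "(\<lambda>k. \<theta> (r k) * T) \<longlonglongrightarrow> 0"
      using tendsto_mult_left_zero[OF LIMSEQ_subseq_LIMSEQ[OF assms(6) lim(1)], of T] by (simp add: o_def)
    have bound: "\<forall>\<^sub>F k in sequentially. L2_sq ?M (d2 (\<Gamma> (r k))) \<le> bending \<beta> + \<epsilon>" if "0 < \<epsilon>" for \<epsilon>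
      using order_tendstoD(2)[OF \<theta>T that]
    proof eventually_elim
      case (elim k)
      then show ?case using T(2)[of "r k"] by linarith
    qed
    have u: "uniform_limit {0..1} (\<lambda>k. d1 (\<Gamma> (r k))) (d1 \<Gamma>0) sequentially"
      using lim(5) unfolding C1_conv_def by (auto elim: uniform_limit_on_subset)
    have zero: "L2 ?M (\<lambda>t. 0 :: real^3)" by (simp add: L2_def)
    have lim0: "(\<lambda>k. \<integral>t. d2 (\<Gamma> (r k)) t \<bullet> 0 \<partial>?M) \<longlonglongrightarrow> 0" by simp
    obtain h where h: "L2 ?M h" "L2_sq ?M h \<le> bending \<beta>"
      "\<And>x y. 0 \<le> x \<Longrightarrow> x \<le> y \<Longrightarrow> y \<le> 1 \<Longrightarrow> (h has_integral d1 \<Gamma>0 y - d1 \<Gamma>0 x) {x..y}"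
      by (rule d2_weak_limit_exists[OF W u _ zero lim0], erule bound) (rule that)
    have "L2_sq ?M (d2 \<Gamma>0) = L2_sq ?M h"
      by (rule density_of_d1_eq_d2(1)[OF lim(2) h(1)]) (rule h(3))
    then show ?thesis
      using h(2) bending_arclength[OF lim(2,3)] by simp
  qed
  show ?thesis
    using lim weak min by blast
qed

end
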